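(* Let $\mathbf{V}$ be a BMN-variety of algebras, let $F \in \mathbf{V}$ be a free algebra of infinite rank, and let $G = \mathrm{Aut}(F)$ be its automorphism group. Then $G$ is a group of universally finite width if and only if there exist moietous subalgebras $U_1, U_2, W$ of $F$ with $F = U_1 * U_2 * W$ such that the width of $G$ relative to the set $$G_{(U_2),\{U_1 * W\}} \cup G_{(U_1),\{U_2 * W\}}$$ is finite.
   Context: Width: for a group $G$ and a generating set $S$ of $G$, the length $|x|_S$ of $x \in G$ is the minimal natural number $k$ such that $x$ is a product of $k$ elements of $S \cup S^{-1}$; the width of $G$ relative to $S$ is the supremum of all $|x|_S$, $x \in G$. A group $G$ is of universally finite width if for every generating set $S$ of $G$ the width of $G$ relative to $S$ is finite. Free products: $*$ denotes the operation of free product (coproduct) in the variety $\mathbf{V}$; $F = U_1 * U_2 * W$ means that $F$ is the (internal) free product of its subalgebras $U_1, U_2, W$, and $U_i * W$ is then the subalgebra of $F$ generated by $U_i \cup W$. Moietous subalgebras: a moiety of an infinite set $I$ is a subset $J \subseteq I$ with $|J| = |I \setminus J|$. A subalgebra of a free algebra $F$ of infinite rank is moietous if it is generated by a moiety of some free basis of $F$. Stabilizers: for $G = \mathrm{Aut}(F)$ and subalgebras $A, B$ of $F$, $G_{(A),\{B\}}$ denotes the subgroup of all elements of $G$ that fix $A$ pointwise and fix $B$ setwise. BMN-variety: a variety of algebras $\mathbf{V}$ is a BMN-variety (Bergman–Macpherson–Neumann variety) if for every free algebra $F \in \mathbf{V}$ of infinite rank and any moietous subalgebras $U_1, U_2,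 W$ of $F$ with $F = U_1 * U_2 * W$, the group $G = \mathrm{Aut}(F)$ is generated by the subgroups $G_{(U_2),\{U_1 * W\}}$ and $G_{(U_1),\{U_2 * W\}}$. *)

theory Defs
  imports "HOL-Algebra.Generated_Groups" "HOL-Algebra.Bij" "HOL-Library.Equipollence" "HOL-Library.Extended_Nat"
begin

section \<open>Algebras, terms and varieties\<close>

text \<open>
  A signature is a partial map from operation symbols to (finite) arities, so that the empty
  signature, hence the variety of all sets, is included. An algebra interprets each symbol by an
  operation on lists; only its values on symbols of the signature and on lists of the right length
  over the carrier matter.
\<close>

type_synonym 'f signature = "'f \<rightharpoonup> nat"

record ('f, 'a) alg = "'a partial_object" +
  oper :: "'f \<Rightarrow> 'a list \<Rightarrow> 'a"

datatype (syms: 'f, vars: 'v) trm = Var 'v | Fun 'f "('f, 'v) trm list"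

record 'f variety =
  sig :: "'f signature"
  identities :: "(('f, nat) trm \<times> ('f, nat) trm) set"

primrec wf_trm :: "'f signature \<Rightarrow> ('f, 'v) trm \<Rightarrow> bool" where
  "wf_trm \<Sigma> (Var x) \<longleftrightarrow> True"
| "wf_trm \<Sigma> (Fun f ts) \<longleftrightarrow> \<Sigma> f = Some (length ts) \<and> list_all (wf_trm \<Sigma>) ts"

primrec eval_trm :: "('f, 'a) alg \<Rightarrow> ('v \<Rightarrow> 'a) \<Rightarrow> ('f, 'v) trm \<Rightarrow> 'a" where
  "eval_trm A e (Var x) = e x"
| "eval_trm A e (Fun f ts) = oper A f (map (eval_trm A e) ts)"

definition closed_under :: "'f signature \<Rightarrow> ('f, 'a) alg \<Rightarrow> 'a set \<Rightarrow> bool" where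
  "closed_under \<Sigma> A B \<longleftrightarrow>
     (\<forall>f xs. \<Sigma> f = Some (length xs) \<and> set xs \<subseteq> B \<longrightarrow> oper A f xs \<in> B)"

definition is_algebra :: "'f signature \<Rightarrow> ('f, 'a) alg \<Rightarrow> bool" where
  "is_algebra \<Sigma> A \<longleftrightarrow> closed_under \<Sigma> A (carrier A)"

definition satisfies :: "('f, 'a) alg \<Rightarrow> ('f, nat) trm \<times> ('f, nat) trm \<Rightarrow> bool" where
  "satisfies A st \<longleftrightarrow> (\<forall>e. range e \<subseteq> carrier A \<longrightarrow> eval_trm A e (fst st) = eval_trm A e (snd st))"

definition is_variety :: "'f variety \<Rightarrow> bool" where
  "is_variety V \<longleftrightarrow> (\<forall>(s, t) \<in> identities V. wf_trm (sig V) s \<and> wf_trm (sig V) t)"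

definition in_variety :: "'f variety \<Rightarrow> ('f, 'a) alg \<Rightarrow> bool" where
  "in_variety V A \<longleftrightarrow> is_algebra (sig V) A \<and> (\<forall>st \<in> identities V. satisfies A st)"

definition is_subalgebra :: "'f variety \<Rightarrow> ('f, 'a) alg \<Rightarrow> 'a set \<Rightarrow> bool" where
  "is_subalgebra V A B \<longleftrightarrow> B \<subseteq> carrier A \<and> closed_under (sig V) A B"

definition generated_subalgebra :: "'f variety \<Rightarrow> ('f, 'a) alg \<Rightarrow> 'a set \<Rightarrow> 'a set" where
  "generated_subalgebra V A X = is_subalgebra V A hull X"

definition alg_hom :: "'f variety \<Rightarrow> ('f, 'a) alg \<Rightarrow> ('f, 'b) alg \<Rightarrow> ('a \<Rightarrow> 'b) set" where
  "alg_hom V A B = {h \<in> carrier A \<rightarrow> carrier B.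
     \<forall>f xs. sig V f = Some (length xs) \<and> set xs \<subseteq> carrier A \<longrightarrow>
       h (oper A f xs) = oper B f (map h xs)}"

text \<open>Automorphisms are made extensional, so that they form a group; cf. \<open>AutoGroup\<close>.\<close>

definition Aut :: "'f variety \<Rightarrow> ('f, 'a) alg \<Rightarrow> ('a \<Rightarrow> 'a) monoid" where
  "Aut V F = BijGroup (carrier F) \<lparr>carrier := alg_hom V F F \<inter> Bij (carrier F)\<rparr>"

definition stab :: "'f variety \<Rightarrow> ('f, 'a) alg \<Rightarrow> 'a set \<Rightarrow> 'a set \<Rightarrow> ('a \<Rightarrow> 'a) set" where
  "stab V F A B = {h \<in> carrier (Aut V F). (\<forall>a\<in>A. h a = a) \<and> h ` B = B}"


section \<open>Free algebras and free products\<close>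

text \<open>
  The two universal properties below quantify over all target algebras in \<open>V\<close> whose carrier is
  contained in the type \<open>('f, 'a) trm\<close>, because a definition cannot quantify over types. This
  type is large enough: lemmas \<open>free_basis_universal\<close> and \<open>free_product3_universal\<close> derive the
  universal properties for target algebras over an arbitrary type.
\<close>

definition free_basis :: "'f variety \<Rightarrow> ('f, 'a) alg \<Rightarrow> 'a set \<Rightarrow> bool" where
  "free_basis V F X \<longleftrightarrow>
     in_variety V F \<and> X \<subseteq> carrier F \<and> generated_subalgebra V F X = carrier F \<and>
     (\<forall>A :: ('f, ('f, 'a) trm) alg. in_variety V A \<longrightarrow>
        (\<forall>g \<in> X \<rightarrow> carrier A. \<exists>h \<in> alg_hom V F A. \<forall>x\<in>X. h x = g x))"

definition free_of_infinite_rank :: "'f variety \<Rightarrow> ('f, 'a) alg \<Rightarrow> bool" where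
  "free_of_infinite_rank V F \<longleftrightarrow> (\<exists>X. free_basis V F X \<and> infinite X)"

definition free_product3 ::
    "'f variety \<Rightarrow> ('f, 'a) alg \<Rightarrow> 'a set \<Rightarrow> 'a set \<Rightarrow> 'a set \<Rightarrow> bool" where
  "free_product3 V F U\<^sub>1 U\<^sub>2 W \<longleftrightarrow>
     in_variety V F \<and> is_subalgebra V F U\<^sub>1 \<and> is_subalgebra V F U\<^sub>2 \<and> is_subalgebra V F W \<and>
     generated_subalgebra V F (U\<^sub>1 \<union> U\<^sub>2 \<union> W) = carrier F \<and>
     (\<forall>A :: ('f, ('f, 'a) trm) alg. in_variety V A \<longrightarrow>
        (\<forall>h\<^sub>1 \<in> alg_hom V (F\<lparr>carrier := U\<^sub>1\<rparr>) A.
         \<forall>h\<^sub>2 \<in> alg_hom V (F\<lparr>carrier := U\<^sub>2\<rparr>) A.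
         \<forall>h\<^sub>3 \<in> alg_hom V (F\<lparr>carrier := W\<rparr>) A.
         \<exists>h \<in> alg_hom V F A.
           (\<forall>x\<in>U\<^sub>1. h x = h\<^sub>1 x) \<and> (\<forall>x\<in>U\<^sub>2. h x = h\<^sub>2 x) \<and> (\<forall>x\<in>W. h x = h\<^sub>3 x)))"

definition moiety :: "'a set \<Rightarrow> 'a set \<Rightarrow> bool" where
  "moiety I J \<longleftrightarrow> infinite I \<and> J \<subseteq> I \<and> J \<approx> I - J"

definition moietous :: "'f variety \<Rightarrow> ('f, 'a) alg \<Rightarrow> 'a set \<Rightarrow> bool" where
  "moietous V F U \<longleftrightarrow>
     (\<exists>X J. free_basis V F X \<and> moiety X J \<and> U = generated_subalgebra V F J)"

text \<open>The type argument is the type containing the carriers of the free algebras considered.\<close>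

definition BMN_variety :: "'a itself \<Rightarrow> 'f variety \<Rightarrow> bool" where
  "BMN_variety _ V \<longleftrightarrow> is_variety V \<and>
     (\<forall>(F :: ('f, 'a) alg) U\<^sub>1 U\<^sub>2 W.
        free_of_infinite_rank V F \<and>
        moietous V F U\<^sub>1 \<and> moietous V F U\<^sub>2 \<and> moietous V F W \<and> free_product3 V F U\<^sub>1 U\<^sub>2 W \<longrightarrow>
        generate (Aut V F)
          (stab V F U\<^sub>2 (generated_subalgebra V F (U\<^sub>1 \<union> W)) \<union>
           stab V F U\<^sub>1 (generated_subalgebra V F (U\<^sub>2 \<union> W))) = carrier (Aut V F))"


section \<open>Width of a group\<close>

text \<open>The infimum over the empty set is \<open>\<infinity>\<close>, the length of an element not generated by \<open>S\<close>.\<close>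

definition group_length :: "('g, 'r) monoid_scheme \<Rightarrow> 'g set \<Rightarrow> 'g \<Rightarrow> enat" where
  "group_length G S x =
     (INF xs \<in> {xs. set xs \<subseteq> S \<union> m_inv G ` S \<and> foldr (mult G) xs (one G) = x}.
        enat (length xs))"

definition group_width :: "('g, 'r) monoid_scheme \<Rightarrow> 'g set \<Rightarrow> enat" where
  "group_width G S = (SUP x \<in> carrier G. group_length G S x)"

definition universally_finite_width :: "('g, 'r) monoid_scheme \<Rightarrow> bool" where
  "universally_finite_width G \<longleftrightarrow>
     (\<forall>S. S \<subseteq> carrier G \<and> generate G S = carrier G \<longrightarrow> group_width G S < \<infinity>)"


section \<open>Basic facts validating the definitions\<close>

lemma eval_in:
  assumes "closed_under \<Sigma> A C" "wf_trm \<Sigma> t" "\<And>x. x \<in> vars t \<Longrightarrow> e x \<in> C"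
  shows "eval_trm A e t \<in> C"
  using assms(2,3)
proof (induction t)
  case (Fun f ts)
  then have "set (map (eval_trm A e) ts) \<subseteq> C" by (auto simp: list_all_iff)
  with assms(1) Fun.prems(1) show ?case
    unfolding closed_under_def by (metis eval_trm.simps(2) length_map wf_trm.simps(2))
qed simp

lemma hom_eval:
  assumes "is_algebra (sig V) B" "h \<in> alg_hom V B A" "wf_trm (sig V) t" "range e \<subseteq> carrier B"
  shows "h (eval_trm B e t) = eval_trm A (h \<circ> e) t"
  using assms(3)
proof (induction t)
  case (Fun f ts)
  have "set (map (eval_trm B e) ts) \<subseteq> carrier B"
    using Fun.prems assms(1,4) eval_in[of "sig V" B "carrier B" _ e]
    by (fastforce simp: list_all_iff is_algebra_def)
  then have "h (eval_trm B e (Fun f ts)) = oper A f (map h (map (eval_trm B e) ts))"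
    using assms(2) Fun.prems unfolding alg_hom_def by simp
  also have "map h (map (eval_trm B e) ts) = map (eval_trm A (h \<circ> e)) ts"
    using Fun by (auto simp: list_all_iff comp_def)
  finally show ?case by (simp only: eval_trm.simps)
qed simp

lemma in_variety_inj_hom:
  assumes V: "is_variety V" "in_variety V A" and B: "is_algebra (sig V) B"
    and h: "h \<in> alg_hom V B A" "inj_on h (carrier B)"
  shows "in_variety V B"
  unfolding in_variety_def satisfies_def
proof (intro conjI ballI allI impI)
  fix st and e :: "nat \<Rightarrow> _" assume st: "st \<in> identities V" and e: "range e \<subseteq> carrier B"
  have wf: "wf_trm (sig V) (fst st)" "wf_trm (sig V) (snd st)"
    using V(1) st by (auto simp: is_variety_def)
  have "range (h \<circ> e) \<subseteq> carrier A" using h e by (auto simp: alg_hom_def)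
  then have "eval_trm A (h \<circ> e) (fst st) = eval_trm A (h \<circ> e) (snd st)"
    using V(2) st unfolding in_variety_def satisfies_def by blast
  then have "h (eval_trm B e (fst st)) = h (eval_trm B e (snd st))"
    using hom_eval[OF B h(1) _ e] wf by simp
  moreover have "eval_trm B e (fst st) \<in> carrier B" "eval_trm B e (snd st) \<in> carrier B"
    using eval_in[of "sig V" B "carrier B" _ e] B wf e by (auto simp: is_algebra_def)
  ultimately show "eval_trm B e (fst st) = eval_trm B e (snd st)" using h(2) by (auto dest: inj_onD)
qed (use B in simp)

primrec encode :: "('f, nat \<times> 'a) trm \<Rightarrow> ('f, 'a) trm" where
  "encode (Var p) = Fun undefined (replicate (Suc (fst p)) (Var (snd p)))"
| "encode (Fun f ts) = Fun f (Fun undefined [] # map encode ts)"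

lemma inj_encode: "inj (encode :: ('f, nat \<times> 'a) trm \<Rightarrow> _)"
proof (rule injI)
  show "s = t" if "encode s = encode t" for s t :: "('f, nat \<times> 'a) trm"
    using that
  proof (induction s arbitrary: t)
    case (Var p)
    show ?case
    proof (cases t)
      case q: (Var q)
      show ?thesis
        using Var unfolding q encode.simps trm.inject replicate_eq_replicate
        by (simp add: prod_eq_iff)
    qed (use Var in simp)
  next
    case (Fun f ts)
    show ?case
    proof (cases t)
      case t: (Fun g us)
      have eq: "f = g" "map encode ts = map encode us" using Fun.prems t by simp_all
      have "ts = us"
      proof (rule nth_equalityI)
        show len: "length ts = length us" using eq(2) by (metis length_map)
        show "ts ! i = us ! i" if "i < length ts" for i
          using Fun.IH[of "ts ! i" "us ! i"] eq(2) len that by (metis nth_map nth_mem)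
      qed
      with eq t show ?thesis by simp
    qed (use Fun.prems in simp)
  qed
qed

lemma small_copy:
  fixes A :: "('f, 'c) alg" and g :: "nat \<times> 'a \<Rightarrow> 'c"
  assumes V: "is_variety V" "in_variety V A" and g: "g ` D \<subseteq> carrier A"
  obtains B :: "('f, ('f, 'a) trm) alg" and h
  where "in_variety V B" "h \<in> alg_hom V B A" "inj_on h (carrier B)" "g ` D \<subseteq> h ` carrier B"
proof -
  let ?T = "{t. wf_trm (sig V) t \<and> vars t \<subseteq> D}"
  define C where "C = eval_trm A g ` ?T"
  have clA: "closed_under (sig V) A (carrier A)"
    using V by (simp add: in_variety_def is_algebra_def)
  have CA: "C \<subseteq> carrier A"
    unfolding C_def using g by (auto intro!: eval_in[OF clA])
  define rep where "rep = inv_into ?T (eval_trm A g)"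
  have rep: "rep c \<in> ?T" "eval_trm A g (rep c) = c" if "c \<in> C" for c
    using inv_into_into[of c "eval_trm A g" ?T] f_inv_into_f[of c "eval_trm A g" ?T] that
    unfolding C_def rep_def by blast+
  have clC: "closed_under (sig V) A C"
    unfolding closed_under_def
  proof (intro allI impI)
    fix f xs assume *: "sig V f = Some (length xs) \<and> set xs \<subseteq> C"
    then have "oper A f xs = eval_trm A g (Fun f (map rep xs))"
      using rep(2) by (auto intro!: arg_cong[of _ _ "oper A f"] map_idI[symmetric])
    moreover have "Fun f (map rep xs) \<in> ?T"
      using * rep(1) by (fastforce simp: list_all_iff)
    ultimately show "oper A f xs \<in> C" unfolding C_def by blast
  qed
  have gC: "g ` D \<subseteq> C"
  proof
    fix y assume "y \<in> g ` D"
    then obtain d where "d \<in> D" "y = eval_trm A g (Var d)" by auto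
    then show "y \<in> C" unfolding C_def by (intro image_eqI[of _ _ "Var d"]) auto
  qed
  define i where "i = encode \<circ> rep"
  have inj: "inj_on i C"
    unfolding i_def
    by (rule comp_inj_on[OF inj_on_inverseI[of C "eval_trm A g"] inj_on_subset[OF inj_encode]])
      (use rep(2) in auto)
  define h where "h = inv_into C i"
  have hi: "h (i c) = c" if "c \<in> C" for c using that inj by (simp add: h_def)
  define B where "B = \<lparr>carrier = i ` C, oper = \<lambda>f xs. i (oper A f (map h xs))\<rparr>"
  have op: "oper A f (map h xs) \<in> C" if "sig V f = Some (length xs)" "set xs \<subseteq> i ` C" for f xs
  proof -
    have "set (map h xs) \<subseteq> C" using that(2) hi by auto
    then show ?thesis using clC that(1) by (simp add: closed_under_def)
  qed
  have B: "is_algebra (sig V) B"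
    using op unfolding is_algebra_def closed_under_def B_def by auto
  have hom: "h \<in> alg_hom V B A"
    using op hi CA unfolding alg_hom_def B_def by auto
  have hinj: "inj_on h (carrier B)"
    unfolding h_def B_def by (simp add: inj_on_inv_into)
  have im: "g ` D \<subseteq> h ` carrier B"
  proof
    fix y assume "y \<in> g ` D"
    then have "y \<in> C" using gC by blast
    then show "y \<in> h ` carrier B"
      using hi unfolding B_def by (intro image_eqI[of _ _ "i y"]) auto
  qed
  show thesis by (rule that[OF in_variety_inj_hom[OF V B hom hinj] hom hinj im])
qed

lemma alg_hom_comp:
  assumes "g \<in> alg_hom V A B" "h \<in> alg_hom V B C"
  shows "h \<circ> g \<in> alg_hom V A C"
proof -
  have "h (g (oper A f xs)) = oper C f (map (h \<circ> g) xs)"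
    if "sig V f = Some (length xs)" "set xs \<subseteq> carrier A" for f xs
  proof -
    have "set (map g xs) \<subseteq> carrier B" using assms(1) that by (auto simp: alg_hom_def)
    then show ?thesis using assms that by (simp add: alg_hom_def)
  qed
  then show ?thesis using assms by (auto simp: alg_hom_def)
qed

lemma alg_hom_lift:
  assumes B: "is_algebra (sig V) B" and A: "is_algebra (sig V) A"
    and h: "h \<in> alg_hom V B C" "inj_on h (carrier B)"
    and g: "g \<in> alg_hom V A C" "g ` carrier A \<subseteq> h ` carrier B"
  shows "inv_into (carrier B) h \<circ> g \<in> alg_hom V A B"
proof -
  let ?k = "inv_into (carrier B) h"
  have k: "?k (g x) \<in> carrier B" "h (?k (g x)) = g x" if "x \<in> carrier A" for x
    using g(2) that by (blast intro: inv_into_into f_inv_into_f)+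
  have "?k (g (oper A f xs)) = oper B f (map (?k \<circ> g) xs)"
    if *: "sig V f = Some (length xs)" "set xs \<subseteq> carrier A" for f xs
  proof -
    have sub: "set (map (?k \<circ> g) xs) \<subseteq> carrier B" using k * by auto
    then have inB: "oper B f (map (?k \<circ> g) xs) \<in> carrier B"
      using B * by (simp add: is_algebra_def closed_under_def)
    have "h (oper B f (map (?k \<circ> g) xs)) = oper C f (map h (map (?k \<circ> g) xs))"
      using h(1) sub * by (simp add: alg_hom_def)
    also have "map h (map (?k \<circ> g) xs) = map g xs" using k * by auto
    also have "oper C f (map g xs) = g (oper A f xs)" using g(1) * by (simp add: alg_hom_def)
    finally have "g (oper A f xs) = h (oper B f (map (?k \<circ> g) xs))" ..
    then show ?thesis using h(2) inB by simp
  qed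
  then show ?thesis using k(1) by (simp add: alg_hom_def)
qed

lemma free_basis_universal:
  fixes F :: "('f, 'a) alg" and A :: "('f, 'c) alg"
  assumes V: "is_variety V" "in_variety V A" and X: "free_basis V F X"
    and g: "g \<in> X \<rightarrow> carrier A"
  shows "\<exists>h \<in> alg_hom V F A. \<forall>x\<in>X. h x = g x"
proof -
  have "(g \<circ> snd) ` ({0 :: nat} \<times> X) \<subseteq> carrier A" using g by auto
  then obtain B :: "('f, ('f, 'a) trm) alg" and p where B: "in_variety V B"
    "p \<in> alg_hom V B A" "inj_on p (carrier B)" "(g \<circ> snd) ` ({0 :: nat} \<times> X) \<subseteq> p ` carrier B"
    using small_copy[OF V] by blast
  have im: "g x \<in> p ` carrier B" if "x \<in> X" for x using B(4) that by force
  let ?k = "inv_into (carrier B) p"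
  have "?k \<circ> g \<in> X \<rightarrow> carrier B" using im by (simp add: inv_into_into)
  with X B(1) obtain h where "h \<in> alg_hom V F B" "\<forall>x\<in>X. h x = (?k \<circ> g) x"
    unfolding free_basis_def by blast
  with B(2) im show ?thesis
    by (intro bexI[of _ "p \<circ> h"]) (auto simp: f_inv_into_f intro: alg_hom_comp)
qed

lemma free_product3_universal:
  fixes F :: "('f, 'a) alg" and A :: "('f, 'c) alg"
  assumes V: "is_variety V" "in_variety V A" and P: "free_product3 V F U\<^sub>1 U\<^sub>2 W"
    and h1: "h\<^sub>1 \<in> alg_hom V (F\<lparr>carrier := U\<^sub>1\<rparr>) A"
    and h2: "h\<^sub>2 \<in> alg_hom V (F\<lparr>carrier := U\<^sub>2\<rparr>) A"
    and h3: "h\<^sub>3 \<in> alg_hom V (F\<lparr>carrier := W\<rparr>) A"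
  shows "\<exists>h \<in> alg_hom V F A.
           (\<forall>x\<in>U\<^sub>1. h x = h\<^sub>1 x) \<and> (\<forall>x\<in>U\<^sub>2. h x = h\<^sub>2 x) \<and> (\<forall>x\<in>W. h x = h\<^sub>3 x)"
proof -
  define g where "g = (\<lambda>(n :: nat, x). if n = 0 then h\<^sub>1 x else if n = 1 then h\<^sub>2 x else h\<^sub>3 x)"
  define D where "D = Pair (0 :: nat) ` U\<^sub>1 \<union> Pair 1 ` U\<^sub>2 \<union> Pair 2 ` W"
  have gD: "g ` D = h\<^sub>1 ` U\<^sub>1 \<union> h\<^sub>2 ` U\<^sub>2 \<union> h\<^sub>3 ` W"
    by (simp add: g_def D_def image_Un image_image)
  have "g ` D \<subseteq> carrier A" using h1 h2 h3 unfolding gD by (auto simp: alg_hom_def)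
  then obtain B :: "('f, ('f, 'a) trm) alg" and p where B: "in_variety V B"
    "p \<in> alg_hom V B A" "inj_on p (carrier B)" "g ` D \<subseteq> p ` carrier B"
    using small_copy[OF V] by blast
  let ?k = "inv_into (carrier B) p"
  have lift: "?k \<circ> h \<in> alg_hom V (F\<lparr>carrier := U\<rparr>) B"
    if "is_subalgebra V F U" "h \<in> alg_hom V (F\<lparr>carrier := U\<rparr>) A" "h ` U \<subseteq> g ` D" for h U
  proof (rule alg_hom_lift[OF _ _ B(2,3) that(2)])
    show "is_algebra (sig V) B" using B(1) by (simp add: in_variety_def)
    show "is_algebra (sig V) (F\<lparr>carrier := U\<rparr>)"
      using that(1) by (simp add: is_subalgebra_def is_algebra_def closed_under_def)
    show "h ` carrier (F\<lparr>carrier := U\<rparr>) \<subseteq> p ` carrier B" using that(3) B(4) by auto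
  qed
  have sub: "is_subalgebra V F U\<^sub>1" "is_subalgebra V F U\<^sub>2" "is_subalgebra V F W"
    using P by (simp_all add: free_product3_def)
  have "?k \<circ> h\<^sub>1 \<in> alg_hom V (F\<lparr>carrier := U\<^sub>1\<rparr>) B" "?k \<circ> h\<^sub>2 \<in> alg_hom V (F\<lparr>carrier := U\<^sub>2\<rparr>) B"
    "?k \<circ> h\<^sub>3 \<in> alg_hom V (F\<lparr>carrier := W\<rparr>) B"
    using lift[OF sub(1) h1] lift[OF sub(2) h2] lift[OF sub(3) h3] unfolding gD by blast+
  with P B(1) obtain h where h: "h \<in> alg_hom V F B" "\<forall>x\<in>U\<^sub>1. h x = (?k \<circ> h\<^sub>1) x"
    "\<forall>x\<in>U\<^sub>2. h x = (?k \<circ> h\<^sub>2) x" "\<forall>x\<in>W. h x = (?k \<circ> h\<^sub>3) x"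
    unfolding free_product3_def by blast
  have pk: "p (?k y) = y" if "y \<in> g ` D" for y
    using B(4) that by (blast intro: f_inv_into_f)
  show ?thesis
    using h pk B(2) unfolding gD
    by (intro bexI[of _ "p \<circ> h"]) (auto intro: alg_hom_comp)
qed

lemma group_Aut:
  assumes "is_algebra (sig V) F"
  shows "group (Aut V F)"
proof -
  have "subgroup (alg_hom V F F \<inter> Bij (carrier F)) (BijGroup (carrier F))"
  proof (rule subgroup.intro)
    show "alg_hom V F F \<inter> Bij (carrier F) \<subseteq> carrier (BijGroup (carrier F))"
      by (simp add: BijGroup_def)
    have ext: "k \<in> alg_hom V F F" if "h \<in> alg_hom V F F" "\<And>x. x \<in> carrier F \<Longrightarrow> k x = h x"
      for h k
    proof -
      have "k (oper F f xs) = oper F f (map k xs)"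
        if *: "sig V f = Some (length xs)" "set xs \<subseteq> carrier F" for f xs
      proof -
        have "oper F f xs \<in> carrier F" 
          using assms * by (simp add: is_algebra_def closed_under_def)
        moreover have "map k xs = map h xs" using * \<open>\<And>x. x \<in> carrier F \<Longrightarrow> k x = h x\<close> by auto
        ultimately show ?thesis
          using * \<open>h \<in> _\<close> \<open>\<And>x. x \<in> carrier F \<Longrightarrow> k x = h x\<close>
          by (simp add: alg_hom_def del: map_eq_conv)
      qed
      then show ?thesis using that by (auto simp: alg_hom_def)
    qed
    have idF: "id \<in> alg_hom V F F" by (simp add: alg_hom_def)
    show "\<one>\<^bsub>BijGroup (carrier F)\<^esub> \<in> alg_hom V F F \<inter> Bij (carrier F)"
      using ext[OF idF] id_Bij by (auto simp: BijGroup_def)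
    fix x assume x: "x \<in> alg_hom V F F \<inter> Bij (carrier F)"
    then have b: "inj_on x (carrier F)" "x ` carrier F = carrier F"
      by (auto simp: Bij_def bij_betw_def)
    have "inv_into (carrier F) x \<circ> id \<in> alg_hom V F F"
      using alg_hom_lift[OF assms assms _ b(1) idF] x b by simp
    then have "restrict (inv_into (carrier F) x) (carrier F) \<in> alg_hom V F F"
      by (rule ext) simp
    then show "inv\<^bsub>BijGroup (carrier F)\<^esub> x \<in> alg_hom V F F \<inter> Bij (carrier F)"
      using x restrict_inv_into_Bij[of x "carrier F"] by (simp add: inv_BijGroup)
    fix y assume y: "y \<in> alg_hom V F F \<inter> Bij (carrier F)"
    have "compose (carrier F) x y \<in> alg_hom V F F"
      using ext[OF alg_hom_comp[of y V F F x F]] x y by (simp add: compose_def)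
    then show "x \<otimes>\<^bsub>BijGroup (carrier F)\<^esub> y \<in> alg_hom V F F \<inter> Bij (carrier F)"
      using x y by (simp add: BijGroup_def compose_Bij)
  qed
  then show ?thesis
    unfolding Aut_def by (rule subgroup.subgroup_is_group[OF _ group_BijGroup])
qed

end

theory Submission
  imports Defs
begin

text \<open>
  Let \<open>Y\<close> be a free basis, \<open>J\<close> a moiety of \<open>Y\<close>, and \<open>H\<close> the group of automorphisms that fix
  \<open>Y - J\<close> pointwise and preserve the subalgebra generated by \<open>J\<close>. Lay out \<open>Y\<close> as a grid
  \<open>J \<times> \<int> \<times> \<int>\<close> with \<open>J\<close> at the origin. Given a sequence \<open>h\<^sub>n\<close> in \<open>H\<close>, let \<open>g\<close> act as \<open>h\<^sub>a\<close> on
  the copies of \<open>J\<close> at \<open>(a, m)\<close> with \<open>a, m \<ge> 0\<close>, let \<open>u\<close> be the horizontal shift of the grid and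
  \<open>v\<close> the vertical shift of column \<open>0\<close> only. Conjugation by \<open>u\<close> moves column \<open>n\<close> of \<open>g\<close> to
  column \<open>0\<close>, and the commutator with \<open>v\<close> kills everything except the copy at the origin, so
  \<open>h\<^sub>n\<close> is the commutator of \<open>u\<^sup>-\<^sup>n g u\<^sup>n\<close> and \<open>v\<close>. Hence, for any generating set, the lengths of
  the \<open>h\<^sub>n\<close> grow at most linearly in \<open>n\<close>; as the sequence is arbitrary, \<open>H\<close> has bounded length.
  Both stabilizers in the theorem are of this form, because bases of infinite rank are equipotent.
\<close>

section \<open>Word length\<close>

context group
begin

lemma foldr_mult_closed:
  assumes "set xs \<subseteq> carrier G" "y \<in> carrier G"
  shows "foldr (mult G) xs y \<in> carrier G"
  using assms(1) by (induction xs) (auto simp: assms(2))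

lemma foldr_mult_append:
  assumes "set xs \<subseteq> carrier G" "set ys \<subseteq> carrier G"
  shows "foldr (mult G) (xs @ ys) \<one> = foldr (mult G) xs \<one> \<otimes> foldr (mult G) ys \<one>"
  using assms(1) by (induction xs) (auto simp: assms(2) foldr_mult_closed m_assoc)

lemma foldr_mult_inv:
  assumes "set xs \<subseteq> carrier G"
  shows "foldr (mult G) (rev (map (m_inv G) xs)) \<one> = inv (foldr (mult G) xs \<one>)"
  using assms
proof (induction xs)
  case (Cons x xs)
  have "set (rev (map (m_inv G) xs)) \<subseteq> carrier G" using Cons.prems by auto
  then have "foldr (mult G) (rev (map (m_inv G) xs) @ [inv x]) \<one> =
      foldr (mult G) (rev (map (m_inv G) xs)) \<one> \<otimes> foldr (mult G) [inv x] \<one>"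
    by (intro foldr_mult_append) (use Cons.prems in auto)
  with Cons show ?case by (simp add: foldr_mult_closed inv_mult_group)
qed simp

text \<open>A finite bound rules out the empty infimum, and a nonempty set of extended naturals
  attains its infimum. Length estimates thus reduce to exhibiting words.\<close>

lemma group_length_le_iff:
  "group_length G S x \<le> enat n \<longleftrightarrow>
    (\<exists>xs. set xs \<subseteq> S \<union> m_inv G ` S \<and> foldr (mult G) xs \<one> = x \<and> length xs \<le> n)"
    (is "_ \<longleftrightarrow> ?R")
proof
  assume le: "group_length G S x \<le> enat n"
  let ?L = "(\<lambda>xs. enat (length xs)) ` {xs. set xs \<subseteq> S \<union> m_inv G ` S \<and> foldr (mult G) xs \<one> = x}"
  have "?L \<noteq> {}"
  proof
    assume "?L = {}"
    then have "group_length G S x = \<infinity>" 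
      by (simp only: group_length_def Inf_empty top_enat_def)
    with le show False by simp
  qed
  then have "Inf ?L \<in> ?L" by (rule wellorder_InfI[OF ex_in_conv[THEN iffD2, THEN someI_ex]])
  then show ?R using le unfolding group_length_def by auto
next
  assume ?R
  then obtain xs where xs: "set xs \<subseteq> S \<union> m_inv G ` S" "foldr (mult G) xs \<one> = x" "length xs \<le> n"
    by blast
  then have "group_length G S x \<le> enat (length xs)"
    unfolding group_length_def by (intro INF_lower) auto
  then show "group_length G S x \<le> enat n" using xs(3) by (meson enat_ord_simps(1) order_trans)
qed

lemma group_length_mult_le:
  assumes "S \<subseteq> carrier G" "group_length G S x \<le> enat m" "group_length G S y \<le> enat n"
  shows "group_length G S (x \<otimes> y) \<le> enat (m + n)"
proof -
  have S: "S \<union> m_inv G ` S \<subseteq> carrier G" using assms(1) by auto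
  obtain xs ys where "set xs \<subseteq> S \<union> m_inv G ` S" "foldr (mult G) xs \<one> = x" "length xs \<le> m"
    "set ys \<subseteq> S \<union> m_inv G ` S" "foldr (mult G) ys \<one> = y" "length ys \<le> n"
    using assms(2,3) unfolding group_length_le_iff by blast
  then show ?thesis
    unfolding group_length_le_iff using S
    by (intro exI[of _ "xs @ ys"]) (use foldr_mult_append[of xs ys] in auto)
qed

lemma group_length_inv_le:
  assumes "S \<subseteq> carrier G" "group_length G S x \<le> enat n"
  shows "group_length G S (inv x) \<le> enat n"
proof -
  have S: "S \<union> m_inv G ` S \<subseteq> carrier G" using assms(1) by auto
  obtain xs where xs: "set xs \<subseteq> S \<union> m_inv G ` S" "foldr (mult G) xs \<one> = x" "length xs \<le> n"
    using assms(2) unfolding group_length_le_iff by blast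
  have "m_inv G ` (S \<union> m_inv G ` S) \<subseteq> S \<union> m_inv G ` S"
    using assms(1) by auto
  then have "set (rev (map (m_inv G) xs)) \<subseteq> S \<union> m_inv G ` S"
    using image_mono[OF xs(1), of "m_inv G"] by (simp only: set_rev set_map)
  moreover have "foldr (mult G) (rev (map (m_inv G) xs)) \<one> = inv x"
    using foldr_mult_inv xs(1,2) S by blast
  ultimately show ?thesis unfolding group_length_le_iff using xs(3)
    by (intro exI[of _ "rev (map (m_inv G) xs)"]) auto
qed

lemma group_length_one: "group_length G S \<one> \<le> enat n"
  unfolding group_length_le_iff by (intro exI[of _ "[]"]) auto

lemma group_length_nat_pow_le:
  assumes "S \<subseteq> carrier G" "group_length G S x \<le> enat n"
  shows "group_length G S (x [^] (k::nat)) \<le> enat (k * n)"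
proof (induction k)
  case 0
  show ?case by (simp add: group_length_one)
next
  case (Suc k)
  show ?case using group_length_mult_le[OF assms(1) Suc assms(2)] by (simp add: add.commute)
qed

lemma group_length_generate:
  assumes "S \<subseteq> carrier G" "x \<in> generate G S"
  obtains n where "group_length G S x \<le> enat n"
proof -
  have "\<exists>n. group_length G S x \<le> enat n"
    using assms(2)
  proof (induction rule: generate.induct)
    case one
    show ?case using group_length_one by blast
  next
    case (incl h)
    then show ?case
      unfolding group_length_le_iff using assms(1) by (intro exI[of _ 1] exI[of _ "[h]"]) auto
  next
    case (inv h)
    then show ?case
      unfolding group_length_le_iff using assms(1) by (intro exI[of _ 1] exI[of _ "[inv h]"]) auto
  next
    case (eng h k)
    then show ?case using group_length_mult_le[OF assms(1)] by blast
  qed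
  then show thesis using that by blast
qed

lemma group_width_finite_iff:
  "group_width G S < \<infinity> \<longleftrightarrow> (\<exists>n. \<forall>x \<in> carrier G. group_length G S x \<le> enat n)"
proof
  assume "group_width G S < \<infinity>"
  then obtain n where "group_width G S \<le> enat n" by (metis less_infinityE order_refl)
  then show "\<exists>n. \<forall>x \<in> carrier G. group_length G S x \<le> enat n"
    unfolding group_width_def SUP_le_iff by blast
next
  assume "\<exists>n. \<forall>x \<in> carrier G. group_length G S x \<le> enat n"
  then obtain n where "group_width G S \<le> enat n"
    unfolding group_width_def SUP_le_iff by blast
  also have "enat n < \<infinity>" by simp
  finally show "group_width G S < \<infinity>" .
qed

text \<open>Substitute words over \<open>S\<close> for the letters of a word over \<open>T\<close>.
  Inverse letters cost no more, so a bound \<open>k\<close> on \<open>T\<close>-length becomes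
  \<open>k * n\<close> for \<open>S\<close>.\<close>

lemma group_width_finite_trans:
  assumes S: "S \<subseteq> carrier G" and T: "group_width G T < \<infinity>"
    and bound: "\<And>x. x \<in> T \<Longrightarrow> group_length G S x \<le> enat n"
  shows "group_width G S < \<infinity>"
proof -
  obtain k where k: "\<And>x. x \<in> carrier G \<Longrightarrow> group_length G T x \<le> enat k"
    using T unfolding group_width_finite_iff by blast
  have fold: "group_length G S (foldr (mult G) xs \<one>) \<le> enat (length xs * n)"
    if "set xs \<subseteq> T \<union> m_inv G ` T" for xs
    using that
  proof (induction xs)
    case Nil
    show ?case by (simp add: group_length_one)
  next
    case (Cons x xs)
    then have "group_length G S x \<le> enat n" using bound group_length_inv_le[OF S] by auto
    then show ?case using group_length_mult_le[OF S] Cons by simp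
  qed
  have "group_length G S x \<le> enat (k * n)" if x: "x \<in> carrier G" for x
  proof -
    obtain xs where xs: "set xs \<subseteq> T \<union> m_inv G ` T" "foldr (mult G) xs \<one> = x" "length xs \<le> k"
      using k[OF x] unfolding group_length_le_iff by blast
    then have "group_length G S x \<le> enat (length xs * n)" using fold by blast
    also have "\<dots> \<le> enat (k * n)" using xs(3) by simp
    finally show ?thesis .
  qed
  then show ?thesis unfolding group_width_finite_iff by blast
qed

text \<open>
  The words on the right-hand side have length linear in \<open>n\<close>, so no sequence of elements of \<open>H\<close>
  can have length growing faster than linearly.
\<close>

lemma group_length_bounded:
  assumes S: "S \<subseteq> carrier G" "generate G S = carrier G"
    and H: "\<And>h :: nat \<Rightarrow> 'a. range h \<subseteq> H \<Longrightarrow>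
      \<exists>g \<in> carrier G. \<exists>u \<in> carrier G. \<exists>v \<in> carrier G. \<forall>n.
        h n = (inv (u [^] n) \<otimes> g \<otimes> u [^] n) \<otimes> (v \<otimes> inv (inv (u [^] n) \<otimes> g \<otimes> u [^] n) \<otimes> inv v)"
  obtains n where "\<And>x. x \<in> H \<Longrightarrow> group_length G S x \<le> enat n"
proof (rule ccontr)
  assume "\<not> thesis"
  \<comment> \<open>The thresholds \<open>n * n\<close> are quadratic, so that a linear upper bound
    will contradict them.\<close>
  then have "\<forall>n. \<exists>x. x \<in> H \<and> \<not> group_length G S x \<le> enat (n * n)" using that by blast
  then obtain h where h: "\<And>n. h n \<in> H" "\<And>n. \<not> group_length G S (h n) \<le> enat (n * n)"
    by metis
  obtain g u v where guv: "g \<in> carrier G" "u \<in> carrier G" "v \<in> carrier G" and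
    hn: "\<And>n. h n = (inv (u [^] n) \<otimes> g \<otimes> u [^] n) \<otimes>
      (v \<otimes> inv (inv (u [^] n) \<otimes> g \<otimes> u [^] n) \<otimes> inv v)"
    using H[of h] h(1) by blast
  obtain a b c where abc: "group_length G S g \<le> enat a" "group_length G S u \<le> enat b"
    "group_length G S v \<le> enat c"
    using group_length_generate[OF S(1)] guv S(2) by metis
  note m = group_length_mult_le[OF S(1)] and i = group_length_inv_le[OF S(1)]
  \<comment> \<open>The commutator word for \<open>h n\<close> has length at most
    \<open>4 * n * b + 2 * a + 2 * c\<close>, which \<open>n * n\<close> dominates for this
    \<open>n\<close>; the summand 1 keeps \<open>n\<close> positive.\<close>
  define n where "n = 4 * b + 2 * a + 2 * c + 1"
  have "group_length G S (u [^] n) \<le> enat (n * b)"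
    by (rule group_length_nat_pow_le[OF S(1) abc(2)])
  then have w: "group_length G S (inv (u [^] n) \<otimes> g \<otimes> u [^] n) \<le> enat (n * b + a + n * b)"
    by (intro m i abc)
  have "group_length G S (h n) \<le>
      enat ((n * b + a + n * b) + (c + (n * b + a + n * b) + c))"
    unfolding hn by (intro m[OF w] m[OF m] i[OF w] i abc)
  also have "\<dots> \<le> enat (n * n)"
  proof -
    have "n * n = 4 * (n * b) + n * (2 * a + 2 * c + 1)"
      by (subst (2) n_def) (simp add: algebra_simps)
    moreover have "2 * a + 2 * c + 1 \<le> n * (2 * a + 2 * c + 1)"
      unfolding n_def by simp
    ultimately show ?thesis by simp
  qed
  finally show False using h(2) by blast
qed

text \<open>Only formal properties of the grid enter: \<open>D\<close> is multiplicative on families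
  in \<open>H\<close>, \<open>P\<close> is multiplicative on permutations, moving \<open>P\<close>
  past \<open>D\<close> reindexes the family, and a family supported at the origin is its single
  entry. All cancellations can then be computed entry by entry.\<close>

lemma commutator_isolates:
  fixes D :: "(int \<times> int \<Rightarrow> 'a) \<Rightarrow> 'a" and P :: "(int \<times> int \<Rightarrow> int \<times> int) \<Rightarrow> 'a"
  assumes H: "subgroup H G"
    and D: "\<And>k. range k \<subseteq> H \<Longrightarrow> D k \<in> carrier G"
    and D_mult: "\<And>k l. range k \<subseteq> H \<Longrightarrow> range l \<subseteq> H \<Longrightarrow> D k \<otimes> D l = D (\<lambda>t. k t \<otimes> l t)"
    and D_single: "\<And>x. x \<in> H \<Longrightarrow> D (\<lambda>t. if t = (0, 0) then x else \<one>) = x"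
    and P: "\<And>\<sigma>. bij \<sigma> \<Longrightarrow> P \<sigma> \<in> carrier G"
    and P_comp: "\<And>\<sigma> \<tau>. bij \<sigma> \<Longrightarrow> bij \<tau> \<Longrightarrow> P \<sigma> \<otimes> P \<tau> = P (\<sigma> \<circ> \<tau>)"
    and D_P: "\<And>k \<sigma>. range k \<subseteq> H \<Longrightarrow> bij \<sigma> \<Longrightarrow> D k \<otimes> P \<sigma> = P \<sigma> \<otimes> D (k \<circ> \<sigma>)"
    and h: "range h \<subseteq> H"
  shows "\<exists>g \<in> carrier G. \<exists>u \<in> carrier G. \<exists>v \<in> carrier G. \<forall>n :: nat.
    h n = (inv (u [^] n) \<otimes> g \<otimes> u [^] n) \<otimes> (v \<otimes> inv (inv (u [^] n) \<otimes> g \<otimes> u [^] n) \<otimes> inv v)"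
proof -
  \<comment> \<open>The cut at row 0 matters: a vertical shift leaves the constant upper part of a
    column unchanged except at that boundary.\<close>
  define \<kappa> where "\<kappa> = (\<lambda>(a :: int, m :: int). if 0 \<le> a \<and> 0 \<le> m then h (nat a) else \<one>)"
  define s where "s = (\<lambda>n (a :: int, m :: int). (a + int n, m))"
  \<comment> \<open>Only column 0 moves. Shifting every column would leave an uncancelled entry in
    row 0 of each column carrying a nontrivial \<open>h\<close>.\<close>
  define \<rho> where "\<rho> = (\<lambda>(a :: int, m :: int). (a, if a = 0 then m + 1 else m))"
  define \<rho>' where "\<rho>' = (\<lambda>(a :: int, m :: int). (a, if a = 0 then m - 1 else m))"
  have s: "bij (s n)" for n
    by (rule o_bij[of "\<lambda>(a, m). (a - int n, m)"]) (auto simp: s_def)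
  have \<rho>\<rho>': "\<rho> \<circ> \<rho>' = id" "\<rho>' \<circ> \<rho> = id" by (auto simp: \<rho>_def \<rho>'_def fun_eq_iff)
  then have \<rho>: "bij \<rho>" using o_bij by blast
  note HG = subgroup.subset[OF H] and one = subgroup.one_closed[OF H]
  have inH: "x \<otimes> y \<in> H" "inv x \<in> H" if "x \<in> H" "y \<in> H" for x y
    using that H by (simp_all add: subgroup.m_closed subgroup.m_inv_closed)
  have \<kappa>: "range \<kappa> \<subseteq> H" using h one by (auto simp: \<kappa>_def image_subset_iff)
  define g u v where "g = D \<kappa>" and "u = P (s 1)" and "v = P \<rho>"
  have guv: "g \<in> carrier G" "u \<in> carrier G" "v \<in> carrier G"
    using D P \<kappa> s \<rho> by (auto simp: g_def u_def v_def)
  \<comment> \<open>\<open>P id\<close> is idempotent, hence trivial.\<close>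
  have P_id: "P id = \<one>"
    using P_comp[of id id] P[of id] by (simp add: l_cancel_one)
  have pow: "u [^] n = P (s n)" for n
  proof (induction n)
    case 0
    have "s 0 = id" by (auto simp: s_def)
    then show ?case by (simp only: nat_pow_0 P_id)
  next
    case (Suc n)
    have "s n \<circ> s 1 = s (Suc n)" by (auto simp: s_def)
    then show ?case using Suc P_comp[OF s s] by (simp add: u_def)
  qed
  have "h n = (inv (u [^] n) \<otimes> g \<otimes> u [^] n) \<otimes> (v \<otimes> inv (inv (u [^] n) \<otimes> g \<otimes> u [^] n) \<otimes> inv v)"
    for n
  proof -
    define k where "k = \<kappa> \<circ> s n"
    define l where "l = (\<lambda>t. inv (k t))"
    have k: "range k \<subseteq> H" using \<kappa> by (auto simp: k_def)
    have l: "range l \<subseteq> H" using k inH(2) by (auto simp: l_def)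
    have l\<rho>: "range (l \<circ> \<rho>') \<subseteq> H" using l by auto
    \<comment> \<open>Moving \<open>u [^] n\<close> to the left past \<open>g\<close> precomposes
      \<kappa> with \<open>s n\<close>, which brings the entries \<open>h n\<close> into column
      0.\<close>
    have w: "inv (u [^] n) \<otimes> g \<otimes> u [^] n = D k"
      using D_P[OF \<kappa> s[of n]] P[OF s[of n]] D[OF k] guv(1)
      by (simp add: pow g_def k_def m_assoc) (simp add: m_assoc[symmetric])
    \<comment> \<open>The constant family is written in this shape so that the single-entry rule
      yields \<open>D\<close> of it at \<open>x = \<one>\<close>.\<close>
    have "(\<lambda>t. k t \<otimes> l t) = (\<lambda>t. if t = (0, 0) then \<one> else \<one>)"
      using k HG by (simp add: l_def image_subset_iff subset_iff)
    then have "D k \<otimes> D l = \<one>" using D_mult[OF k l] D_single[OF one] by simp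
    then have "inv (D k) = D l"
      using D k l inv_equality inv_comm by metis
    \<comment> \<open>Moving \<open>v\<close> past \<open>D (l \<circ> \<rho>')\<close> composes
      with \<rho> and gives back \<open>l\<close>.\<close>
    moreover have "v \<otimes> D l \<otimes> inv v = D (l \<circ> \<rho>')"
    proof -
      have "D (l \<circ> \<rho>') \<otimes> v = v \<otimes> D l"
        using D_P[OF l\<rho> \<rho>] \<rho>\<rho>'(2) by (simp add: v_def comp_assoc)
      then show ?thesis using guv D[OF l\<rho>] D[OF l] by (metis inv_solve_right' m_closed)
    qed
    moreover have "D k \<otimes> D (l \<circ> \<rho>') = h n"
    proof -
      have hG: "h n \<in> carrier G" for n using h HG by auto
      \<comment> \<open>Outside column 0 each entry meets its own inverse. In column 0 the entry in
        row \<open>m\<close> meets the inverse of the one in row \<open>m - 1\<close>; these differ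
        only at \<open>m = 0\<close>, where \<open>h n\<close> meets \<one>.\<close>
      have "(\<lambda>t. k t \<otimes> (l \<circ> \<rho>') t) = (\<lambda>t. if t = (0, 0) then h n else \<one>)"
        by (auto simp: fun_eq_iff k_def l_def \<rho>'_def s_def \<kappa>_def hG)
      then show ?thesis using D_mult[OF k l\<rho>] D_single h by auto
    qed
    ultimately show ?thesis by (simp add: w)
  qed
  then show ?thesis using guv by blast
qed

end

section \<open>Generated subalgebras\<close>

lemma generated_subalgebra_incl: "X \<subseteq> generated_subalgebra V A X"
  unfolding generated_subalgebra_def by (rule hull_subset)

lemma generated_subalgebra_mono:
  "X \<subseteq> Y \<Longrightarrow> generated_subalgebra V A X \<subseteq> generated_subalgebra V A Y"
  unfolding generated_subalgebra_def by (rule hull_mono)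

lemma generated_subalgebra_minimal:
  "X \<subseteq> B \<Longrightarrow> is_subalgebra V A B \<Longrightarrow> generated_subalgebra V A X \<subseteq> B"
  unfolding generated_subalgebra_def by (rule hull_minimal)

lemma is_subalgebra_carrier: "is_algebra (sig V) A \<Longrightarrow> is_subalgebra V A (carrier A)"
  by (simp add: is_subalgebra_def is_algebra_def)

lemma is_subalgebra_generated:
  assumes "is_algebra (sig V) A" "X \<subseteq> carrier A"
  shows "is_subalgebra V A (generated_subalgebra V A X)"
proof -
  have "generated_subalgebra V A X \<subseteq> carrier A"
    by (rule generated_subalgebra_minimal[OF assms(2) is_subalgebra_carrier[OF assms(1)]])
  moreover have "closed_under (sig V) A (generated_subalgebra V A X)"
    unfolding generated_subalgebra_def hull_def is_subalgebra_def closed_under_def by blast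
  ultimately show ?thesis by (simp add: is_subalgebra_def)
qed

lemma generated_subalgebra_eqI:
  assumes "is_algebra (sig V) A" "X \<subseteq> carrier A" "Y \<subseteq> carrier A"
    and "X \<subseteq> generated_subalgebra V A Y" "Y \<subseteq> generated_subalgebra V A X"
  shows "generated_subalgebra V A X = generated_subalgebra V A Y"
  by (intro subset_antisym generated_subalgebra_minimal is_subalgebra_generated assms)

lemma generated_subalgebra_Un:
  assumes "is_algebra (sig V) A" "X \<subseteq> carrier A" "Y \<subseteq> carrier A"
  shows "generated_subalgebra V A (generated_subalgebra V A X \<union> generated_subalgebra V A Y) =
    generated_subalgebra V A (X \<union> Y)"
proof (rule generated_subalgebra_eqI[OF assms(1)])
  show "generated_subalgebra V A X \<union> generated_subalgebra V A Y \<subseteq> carrier A"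
    using is_subalgebra_generated[OF assms(1)] assms(2,3) by (simp add: is_subalgebra_def)
  show "generated_subalgebra V A X \<union> generated_subalgebra V A Y \<subseteq> generated_subalgebra V A (X \<union> Y)"
    by (simp add: generated_subalgebra_mono)
  have "X \<union> Y \<subseteq> generated_subalgebra V A X \<union> generated_subalgebra V A Y"
    by (intro Un_mono generated_subalgebra_incl)
  also have "\<dots> \<subseteq> generated_subalgebra V A (generated_subalgebra V A X \<union> generated_subalgebra V A Y)"
    by (rule generated_subalgebra_incl)
  finally show "X \<union> Y \<subseteq> \<dots>" .
qed (use assms in auto)

text \<open>Operations are finitary: the arguments of one operation have finite supports whose union
  is still finite. Hence the subalgebras generated by finite subsets of \<open>X\<close> have a
  union that is a subalgebra containing \<open>X\<close>.\<close>

lemma finite_support: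
  assumes "is_algebra (sig V) A" "X \<subseteq> carrier A" "x \<in> generated_subalgebra V A X"
  obtains D where "finite D" "D \<subseteq> X" "x \<in> generated_subalgebra V A D"
proof -
  let ?U = "\<Union>D \<in> {D. finite D \<and> D \<subseteq> X}. generated_subalgebra V A D"
  have sub: "is_subalgebra V A (generated_subalgebra V A D)" if "D \<subseteq> X" for D
    using is_subalgebra_generated[OF assms(1)] assms(2) that by auto
  have "closed_under (sig V) A ?U"
    unfolding closed_under_def
  proof (intro allI impI)
    fix f xs assume *: "sig V f = Some (length xs) \<and> set xs \<subseteq> ?U"
    then have "\<forall>y \<in> set xs. \<exists>D. finite D \<and> D \<subseteq> X \<and> y \<in> generated_subalgebra V A D" by blast
    then obtain d where d: "\<And>y. y \<in> set xs \<Longrightarrow>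
        finite (d y) \<and> d y \<subseteq> X \<and> y \<in> generated_subalgebra V A (d y)"
      by metis
    let ?D = "\<Union>y \<in> set xs. d y"
    have "y \<in> generated_subalgebra V A ?D" if "y \<in> set xs" for y
      using d[OF that] generated_subalgebra_mono[OF UN_upper[OF that], of V A d] by blast
    then have "set xs \<subseteq> generated_subalgebra V A ?D" by blast
    moreover have D: "?D \<subseteq> X" using d by blast
    ultimately have "oper A f xs \<in> generated_subalgebra V A ?D"
      using sub[OF D] * by (simp add: is_subalgebra_def closed_under_def)
    moreover have "finite ?D" using d by blast
    ultimately show "oper A f xs \<in> ?U" using D by (intro UN_I[of ?D]) simp_all
  qed
  moreover have "?U \<subseteq> carrier A"
    using sub unfolding is_subalgebra_def by (intro UN_least) simp
  ultimately have "is_subalgebra V A ?U" by (simp add: is_subalgebra_def)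
  moreover have "X \<subseteq> ?U"
  proof
    fix y assume "y \<in> X"
    then show "y \<in> ?U"
      using generated_subalgebra_incl[of "{y}" V A] by (intro UN_I[of "{y}"]) auto
  qed
  ultimately have "generated_subalgebra V A X \<subseteq> ?U" by (intro generated_subalgebra_minimal)
  then have "x \<in> ?U" using assms(3) by (rule subsetD)
  then show thesis using that by blast
qed

section \<open>Homomorphisms and their values on generators\<close>

lemma alg_hom_restrict_carrier:
  assumes "h \<in> alg_hom V A B" "is_subalgebra V A U"
  shows "h \<in> alg_hom V (A\<lparr>carrier := U\<rparr>) B"
  using assms unfolding alg_hom_def is_subalgebra_def by (auto simp: subset_iff)

lemma alg_hom_cong:
  assumes "is_algebra (sig V) A" "h \<in> alg_hom V A B" "\<And>x. x \<in> carrier A \<Longrightarrow> k x = h x"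
  shows "k \<in> alg_hom V A B"
proof -
  have "k (oper A f xs) = oper B f (map k xs)"
    if *: "sig V f = Some (length xs)" "set xs \<subseteq> carrier A" for f xs
  proof -
    have "oper A f xs \<in> carrier A"
      using assms(1) * by (simp add: is_algebra_def closed_under_def)
    moreover have "map k xs = map h xs" using * assms(3) by auto
    ultimately show ?thesis
      using * assms(2,3) by (simp add: alg_hom_def del: map_eq_conv)
  qed
  then show ?thesis using assms(2,3) by (auto simp: alg_hom_def)
qed

text \<open>The equalizer of two homomorphisms is a subalgebra.\<close>

lemma alg_hom_eq_on_generated:
  assumes X: "X \<subseteq> U" and U: "is_subalgebra V A U"
    and hk: "h \<in> alg_hom V (A\<lparr>carrier := U\<rparr>) B" "k \<in> alg_hom V (A\<lparr>carrier := U\<rparr>) B"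
    and eq: "\<And>x. x \<in> X \<Longrightarrow> h x = k x" and x: "x \<in> generated_subalgebra V A X"
  shows "h x = k x"
proof -
  have "oper A f xs \<in> {x \<in> U. h x = k x}"
    if *: "sig V f = Some (length xs)" "set xs \<subseteq> {x \<in> U. h x = k x}" for f xs
  proof -
    have "set xs \<subseteq> U" using * by blast
    moreover have "map h xs = map k xs" using * by auto
    ultimately show ?thesis
      using U hk * by (simp add: is_subalgebra_def closed_under_def alg_hom_def del: map_eq_conv)
  qed
  then have "is_subalgebra V A {x \<in> U. h x = k x}"
    using U unfolding is_subalgebra_def closed_under_def by blast
  then have "generated_subalgebra V A X \<subseteq> {x \<in> U. h x = k x}"
    using X eq by (intro generated_subalgebra_minimal) auto
  then show ?thesis using x by blast
qed

lemma alg_hom_eqI: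
  assumes "is_algebra (sig V) A" "X \<subseteq> carrier A" "h \<in> alg_hom V A B" "k \<in> alg_hom V A B"
    and "\<And>x. x \<in> X \<Longrightarrow> h x = k x" "x \<in> generated_subalgebra V A X"
  shows "h x = k x"
  by (rule alg_hom_eq_on_generated[OF assms(2) is_subalgebra_carrier[OF assms(1)] _ _ assms(5,6)])
    (use assms in auto)

section \<open>Free bases\<close>

lemma free_basisD:
  assumes "free_basis V F X"
  shows "in_variety V F" "is_algebra (sig V) F" "X \<subseteq> carrier F"
    "generated_subalgebra V F X = carrier F"
  using assms unfolding free_basis_def in_variety_def by blast+

text \<open>Otherwise the endomorphism sending \<open>x\<close> to another basis element and fixing
  the rest of \<open>X\<close> would be the identity on \<open>D\<close>, hence on the subalgebra it
  generates, and would fix \<open>x\<close>.\<close>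

lemma free_basis_independent:
  assumes V: "is_variety V" and X: "free_basis V F X" "infinite X"
    and D: "D \<subseteq> X" "x \<in> X" "x \<in> generated_subalgebra V F D"
  shows "x \<in> D"
proof (rule ccontr)
  assume "x \<notin> D"
  note F = free_basisD[OF X(1)]
  have "infinite (X - {x})" using X(2) by simp
  then obtain y where y: "y \<in> X" "y \<noteq> x" using infinite_imp_nonempty by blast
  have "(\<lambda>z. if z = x then y else z) \<in> X \<rightarrow> carrier F" using F(3) y by auto
  then obtain h where h: "h \<in> alg_hom V F F" "\<And>z. z \<in> X \<Longrightarrow> h z = (if z = x then y else z)"
    using free_basis_universal[OF V F(1) X(1)] by blast
  have id: "id \<in> alg_hom V F F" by (simp add: alg_hom_def)
  have "h x = id x"
  proof (rule alg_hom_eqI[OF F(2) _ h(1) id _ D(3)])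
    show "h z = id z" if "z \<in> D" for z using h(2)[of z] that D(1) \<open>x \<notin> D\<close> by auto
  qed (use D(1) F(3) in auto)
  then show False using h(2) D(2) y by auto
qed

lemma lepoll_iff_ordLeq: "A \<lesssim> B \<longleftrightarrow> ordLeq3 (card_of A) (card_of B)"
  by (simp add: lepoll_def card_of_ordLeq)

text \<open>Express every element of \<open>Y\<close> by finitely many elements of \<open>X\<close>.
  The elements used generate \<open>F\<close>, so by independence they exhaust \<open>X\<close>; a
  union of finite sets indexed by the infinite set \<open>Y\<close> has at most the size of
  \<open>Y\<close>.\<close>

lemma free_basis_lepoll:
  assumes V: "is_variety V" and X: "free_basis V F X" "infinite X" and Y: "free_basis V F Y" "infinite Y"
  shows "X \<lesssim> Y"
proof -
  note F = free_basisD[OF X(1)] and G = free_basisD[OF Y(1)]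
  have "\<exists>D. finite D \<and> D \<subseteq> X \<and> y \<in> generated_subalgebra V F D" if "y \<in> Y" for y
  proof -
    have "y \<in> generated_subalgebra V F X" using that F(4) G(3) by auto
    then show ?thesis using finite_support[OF F(2,3)] by metis
  qed
  then obtain d where d: "\<And>y. y \<in> Y \<Longrightarrow> finite (d y) \<and> d y \<subseteq> X \<and> y \<in> generated_subalgebra V F (d y)"
    by metis
  let ?D = "\<Union>y\<in>Y. d y"
  have D: "?D \<subseteq> X" using d by blast
  have "y \<in> generated_subalgebra V F ?D" if "y \<in> Y" for y
    using d[OF that] generated_subalgebra_mono[OF UN_upper[OF that], of V F d] by blast
  then have "Y \<subseteq> generated_subalgebra V F ?D" by blast
  then have "carrier F \<subseteq> generated_subalgebra V F ?D"
    unfolding G(4)[symmetric] using D F(3)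
    by (intro generated_subalgebra_minimal is_subalgebra_generated[OF F(2)]) auto
  then have "x \<in> ?D" if "x \<in> X" for x
    using free_basis_independent[OF V X D that] F(3) that by auto
  then have "X \<subseteq> ?D" by blast
  moreover have "?D \<lesssim> Y"
    unfolding lepoll_iff_ordLeq
  proof (rule card_of_UNION_ordLeq_infinite[OF Y(2)])
    show "\<forall>y\<in>Y. ordLeq3 (card_of (d y)) (card_of Y)"
      using d Y(2) by (simp add: finite_lepoll_infinite flip: lepoll_iff_ordLeq)
  qed (simp add: card_of_mono1)
  ultimately show ?thesis using subset_imp_lepoll lepoll_trans by blast
qed

lemma free_basis_eqpoll:
  assumes "is_variety V" "free_basis V F X" "infinite X" "free_basis V F Y" "infinite Y"
  shows "X \<approx> Y"
  using assms by (simp add: free_basis_lepoll lepoll_antisym)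

section \<open>Free products of moietous subalgebras\<close>

lemma free_product3_partition:
  assumes V: "is_variety V" and X: "free_basis V F X"
    and J: "X = J\<^sub>1 \<union> J\<^sub>2 \<union> J\<^sub>3" "J\<^sub>1 \<inter> J\<^sub>2 = {}" "J\<^sub>1 \<inter> J\<^sub>3 = {}" "J\<^sub>2 \<inter> J\<^sub>3 = {}"
  shows "free_product3 V F (generated_subalgebra V F J\<^sub>1) (generated_subalgebra V F J\<^sub>2)
    (generated_subalgebra V F J\<^sub>3)"
proof -
  note F = free_basisD[OF X]
  let ?g = "generated_subalgebra V F"
  have JF: "J\<^sub>1 \<subseteq> carrier F" "J\<^sub>2 \<subseteq> carrier F" "J\<^sub>3 \<subseteq> carrier F" using J(1) F(3) by auto
  note sub = is_subalgebra_generated[OF F(2)]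
  have "X \<subseteq> ?g J\<^sub>1 \<union> ?g J\<^sub>2 \<union> ?g J\<^sub>3"
    unfolding J(1) by (intro Un_mono generated_subalgebra_incl)
  then have "carrier F \<subseteq> ?g (?g J\<^sub>1 \<union> ?g J\<^sub>2 \<union> ?g J\<^sub>3)"
    unfolding F(4)[symmetric] by (rule generated_subalgebra_mono)
  moreover have "?g (?g J\<^sub>1 \<union> ?g J\<^sub>2 \<union> ?g J\<^sub>3) \<subseteq> carrier F"
    using sub[OF JF(1)] sub[OF JF(2)] sub[OF JF(3)]
    by (intro generated_subalgebra_minimal is_subalgebra_carrier F(2))
      (simp add: is_subalgebra_def)
  ultimately have gen: "?g (?g J\<^sub>1 \<union> ?g J\<^sub>2 \<union> ?g J\<^sub>3) = carrier F" by blast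
  have univ: "\<exists>h \<in> alg_hom V F A.
      (\<forall>x\<in>?g J\<^sub>1. h x = h\<^sub>1 x) \<and> (\<forall>x\<in>?g J\<^sub>2. h x = h\<^sub>2 x) \<and> (\<forall>x\<in>?g J\<^sub>3. h x = h\<^sub>3 x)"
    if A: "in_variety V A" and h: "h\<^sub>1 \<in> alg_hom V (F\<lparr>carrier := ?g J\<^sub>1\<rparr>) A"
      "h\<^sub>2 \<in> alg_hom V (F\<lparr>carrier := ?g J\<^sub>2\<rparr>) A" "h\<^sub>3 \<in> alg_hom V (F\<lparr>carrier := ?g J\<^sub>3\<rparr>) A"
    for A :: "('a, ('a, 'b) trm) alg" and h\<^sub>1 h\<^sub>2 h\<^sub>3
  proof -
    \<comment> \<open>The homomorphisms are pasted on the basis; disjointness of the pieces makes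
      the order of the cases immaterial. Agreement on generators then carries over to each
      factor.\<close>
    let ?h = "\<lambda>x. if x \<in> J\<^sub>1 then h\<^sub>1 x else if x \<in> J\<^sub>2 then h\<^sub>2 x else h\<^sub>3 x"
    have "h' x \<in> carrier A" if "h' \<in> alg_hom V (F\<lparr>carrier := ?g J\<rparr>) A" "x \<in> J" for h' J x
      using that generated_subalgebra_incl[of J V F] by (auto simp: alg_hom_def)
    then have "?h \<in> X \<rightarrow> carrier A" using h unfolding J(1) by auto
    then obtain k where k: "k \<in> alg_hom V F A" "\<And>x. x \<in> X \<Longrightarrow> k x = ?h x"
      using free_basis_universal[OF V A X] by blast
    have eq: "\<forall>x \<in> ?g J. k x = h' x"
      if "J \<subseteq> carrier F" "h' \<in> alg_hom V (F\<lparr>carrier := ?g J\<rparr>) A" "\<And>x. x \<in> J \<Longrightarrow> k x = h' x"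
      for J h'
      using alg_hom_eq_on_generated[OF generated_subalgebra_incl sub[OF that(1)]
          alg_hom_restrict_carrier[OF k(1) sub[OF that(1)]] that(2,3)] by blast
    show ?thesis
      using k(2) J by (intro bexI[OF _ k(1)] conjI eq JF h) auto
  qed
  show ?thesis
    unfolding free_product3_def by (intro conjI F(1) sub JF gen allI impI ballI univ)
qed

section \<open>Cardinalities of moieties\<close>

lemma moietyI:
  assumes "infinite X" "J \<subseteq> X" "K \<subseteq> X" "J \<inter> K = {}" "J \<approx> X" "K \<approx> X"
  shows "moiety X J"
proof -
  have "X \<lesssim> K" using assms(6) by (simp add: eqpoll_imp_lepoll eqpoll_sym)
  also have "K \<lesssim> X - J" using assms(3,4) by (intro subset_imp_lepoll) blast
  finally have "X - J \<approx> X" by (simp add: lepoll_antisym subset_imp_lepoll)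
  then have "J \<approx> X - J" using assms(5) by (meson eqpoll_sym eqpoll_trans)
  then show ?thesis using assms(1,2) by (simp add: moiety_def)
qed

text \<open>Transport the three layers of \<open>X \<times> {0, 1, 2}\<close> along a bijection with
  \<open>X\<close>. Each piece has full size, and its complement contains another piece of full
  size.\<close>

lemma infinite_split3:
  assumes "infinite X"
  obtains J\<^sub>1 J\<^sub>2 J\<^sub>3 where "X = J\<^sub>1 \<union> J\<^sub>2 \<union> J\<^sub>3" "J\<^sub>1 \<inter> J\<^sub>2 = {}" "J\<^sub>1 \<inter> J\<^sub>3 = {}" "J\<^sub>2 \<inter> J\<^sub>3 = {}"
    "moiety X J\<^sub>1" "moiety X J\<^sub>2" "moiety X J\<^sub>3"
proof -
  have "ordLeq3 (card_of {0::nat, 1, 2}) (card_of X)"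
    using assms by (simp add: finite_lepoll_infinite flip: lepoll_iff_ordLeq)
  then have "X \<times> {0::nat, 1, 2} \<approx> X"
    using card_of_Times_infinite[OF assms, of "{0::nat, 1, 2}"]
    by (simp add: eqpoll_iff_card_of_ordIso)
  then obtain b where b: "bij_betw b (X \<times> {0::nat, 1, 2}) X"
    unfolding eqpoll_def by (rule exE)
  define J where "J = (\<lambda>i. b ` (X \<times> {i}))"
  have "X \<times> {0, 1, 2} = X \<times> {0} \<union> X \<times> {1} \<union> X \<times> {2::nat}" by auto
  then have "b ` (X \<times> {0, 1, 2}) = J 0 \<union> J 1 \<union> J 2"
    unfolding J_def by (simp only: image_Un)
  then have X: "X = J 0 \<union> J 1 \<union> J 2" using b by (simp add: bij_betw_def)
  have inj: "inj_on b (X \<times> {0, 1, 2})" using b by (simp add: bij_betw_def)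
  have disj: "J i \<inter> J j = {}" if "i \<in> {0, 1, 2}" "j \<in> {0, 1, 2}" "i \<noteq> j" for i j
  proof -
    have "J i \<inter> J j = b ` (X \<times> {i} \<inter> X \<times> {j})"
      unfolding J_def using that by (intro inj_on_image_Int[OF inj, symmetric]) auto
    also have "X \<times> {i} \<inter> X \<times> {j} = {}" using that(3) by auto
    finally show ?thesis by simp
  qed
  have J: "J i \<approx> X" if "i \<in> {0, 1, 2}" for i
  proof -
    have "X \<times> {i} \<subseteq> X \<times> {0, 1, 2}" using that by auto
    then have "J i \<approx> X \<times> {i}"
      unfolding J_def by (intro inj_on_image_eqpoll_self inj_on_subset[OF inj])
    also have "X \<times> {i} \<approx> X" by (rule eqpoll_trans[OF times_commute_eqpoll times_singleton_eqpoll])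
    finally show ?thesis .
  qed
  have sub: "J 0 \<subseteq> X" "J 1 \<subseteq> X" "J 2 \<subseteq> X" using X by blast+
  have d: "J 0 \<inter> J 1 = {}" "J 0 \<inter> J 2 = {}" "J 1 \<inter> J 2 = {}" "J 1 \<inter> J 0 = {}" "J 2 \<inter> J 0 = {}"
    by (intro disj; simp)+
  have e: "J 0 \<approx> X" "J 1 \<approx> X" "J 2 \<approx> X" by (rule J; simp)+
  show thesis
    by (rule that[OF X d(1-3) moietyI[OF assms sub(1,2) d(1) e(1,2)]
        moietyI[OF assms sub(2,1) d(4) e(2,1)] moietyI[OF assms sub(3,1) d(5) e(3,1)]])
qed

lemma Un_lepoll_infinite:
  assumes "infinite C" "A \<lesssim> C" "B \<lesssim> C"
  shows "A \<union> B \<lesssim> C"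
  using assms card_of_Un_ordLeq_infinite_Field[of "card_of C" A B]
  by (simp add: lepoll_iff_ordLeq Field_card_of card_of_card_order_on)

text \<open>\<open>J\<close> is infinite, since otherwise both halves of \<open>X\<close> would be
  finite, and a union of two sets of the size of an infinite \<open>J\<close> has that size
  again.\<close>

lemma moiety_eqpoll:
  assumes "moiety X J"
  shows "J \<approx> X"
proof -
  have J: "infinite X" "J \<subseteq> X" "J \<approx> X - J" using assms by (auto simp: moiety_def)
  then have inf: "infinite J" using eqpoll_finite_iff by (metis Diff_infinite_finite)
  have "X - J \<lesssim> J" using J(3) by (simp add: eqpoll_imp_lepoll eqpoll_sym)
  then have "J \<union> (X - J) \<lesssim> J" using inf by (intro Un_lepoll_infinite lepoll_refl)
  moreover have "J \<union> (X - J) = X" using J(2) by blast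
  ultimately show ?thesis using J(2) by (simp add: lepoll_antisym subset_imp_lepoll)
qed

section \<open>A common basis for three free factors\<close>

lemma free_basis_extend:
  assumes V: "is_variety V" "in_variety V A" and X: "free_basis V F X" "J \<subseteq> X" "J \<noteq> {}"
    and g: "g \<in> J \<rightarrow> carrier A"
  obtains h where "h \<in> alg_hom V (F\<lparr>carrier := generated_subalgebra V F J\<rparr>) A"
    "\<And>x. x \<in> J \<Longrightarrow> h x = g x"
proof -
  note F = free_basisD[OF X(1)]
  obtain j where "j \<in> J" using X(3) by blast
  \<comment> \<open>Basis elements outside \<open>J\<close> need some value in \<open>A\<close>;
    nonemptiness of \<open>J\<close> provides \<open>g j\<close>.\<close>
  then have "(\<lambda>x. if x \<in> J then g x else g j) \<in> X \<rightarrow> carrier A" using g by auto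
  then obtain h where h: "h \<in> alg_hom V F A" "\<And>x. x \<in> X \<Longrightarrow> h x = (if x \<in> J then g x else g j)"
    using free_basis_universal[OF V X(1)] by blast
  have "J \<subseteq> carrier F" using X(2) F(3) by blast
  then show thesis
    using that[OF alg_hom_restrict_carrier[OF h(1) is_subalgebra_generated[OF F(2)]]] h(2) X(2)
    by (metis subsetD)
qed

text \<open>Disjointness holds because \<open>V\<close> has an algebra with more than one element, namely \<open>F\<close>.\<close>

lemma free_basis_of_product:
  assumes V: "is_variety V"
    and X: "free_basis V F X\<^sub>1" "free_basis V F X\<^sub>2" "free_basis V F X\<^sub>3"
    and J: "moiety X\<^sub>1 J\<^sub>1" "moiety X\<^sub>2 J\<^sub>2" "moiety X\<^sub>3 J\<^sub>3"
    and P: "free_product3 V F (generated_subalgebra V F J\<^sub>1) (generated_subalgebra V F J\<^sub>2)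
      (generated_subalgebra V F J\<^sub>3)"
  shows "free_basis V F (J\<^sub>1 \<union> J\<^sub>2 \<union> J\<^sub>3)" "J\<^sub>1 \<inter> J\<^sub>2 = {}" "J\<^sub>1 \<inter> J\<^sub>3 = {}" "J\<^sub>2 \<inter> J\<^sub>3 = {}"
proof -
  let ?g = "generated_subalgebra V F"
  note F = free_basisD[OF X(1)]
  have JX: "J\<^sub>1 \<subseteq> X\<^sub>1" "J\<^sub>2 \<subseteq> X\<^sub>2" "J\<^sub>3 \<subseteq> X\<^sub>3" using J by (auto simp: moiety_def)
  have ne: "J\<^sub>1 \<noteq> {}" "J\<^sub>2 \<noteq> {}" "J\<^sub>3 \<noteq> {}"
    using J by (auto simp: moiety_def dest: eqpoll_sym)
  have JF: "J\<^sub>1 \<subseteq> carrier F" "J\<^sub>2 \<subseteq> carrier F" "J\<^sub>3 \<subseteq> carrier F"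
    using JX free_basisD(3)[OF X(1)] free_basisD(3)[OF X(2)] free_basisD(3)[OF X(3)] by auto
  \<comment> \<open>Each prescription extends from \<open>J\<^sub>i\<close> to its factor by means
    of its own ambient basis; the free product then joins the three extensions.\<close>
  have joint: "\<exists>h \<in> alg_hom V F A.
      (\<forall>x\<in>J\<^sub>1. h x = g\<^sub>1 x) \<and> (\<forall>x\<in>J\<^sub>2. h x = g\<^sub>2 x) \<and> (\<forall>x\<in>J\<^sub>3. h x = g\<^sub>3 x)"
    if A: "in_variety V A" and g: "g\<^sub>1 \<in> J\<^sub>1 \<rightarrow> carrier A" "g\<^sub>2 \<in> J\<^sub>2 \<rightarrow> carrier A" "g\<^sub>3 \<in> J\<^sub>3 \<rightarrow> carrier A"
    for A :: "('a, 'c) alg" and g\<^sub>1 g\<^sub>2 g\<^sub>3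
  proof -
    obtain h\<^sub>1 where h1: "h\<^sub>1 \<in> alg_hom V (F\<lparr>carrier := ?g J\<^sub>1\<rparr>) A" "\<And>x. x \<in> J\<^sub>1 \<Longrightarrow> h\<^sub>1 x = g\<^sub>1 x"
      using free_basis_extend[OF V A X(1) JX(1) ne(1) g(1)] by blast
    obtain h\<^sub>2 where h2: "h\<^sub>2 \<in> alg_hom V (F\<lparr>carrier := ?g J\<^sub>2\<rparr>) A" "\<And>x. x \<in> J\<^sub>2 \<Longrightarrow> h\<^sub>2 x = g\<^sub>2 x"
      using free_basis_extend[OF V A X(2) JX(2) ne(2) g(2)] by blast
    obtain h\<^sub>3 where h3: "h\<^sub>3 \<in> alg_hom V (F\<lparr>carrier := ?g J\<^sub>3\<rparr>) A" "\<And>x. x \<in> J\<^sub>3 \<Longrightarrow> h\<^sub>3 x = g\<^sub>3 x"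
      using free_basis_extend[OF V A X(3) JX(3) ne(3) g(3)] by blast
    obtain h where "h \<in> alg_hom V F A" "\<forall>x\<in>?g J\<^sub>1. h x = h\<^sub>1 x" "\<forall>x\<in>?g J\<^sub>2. h x = h\<^sub>2 x"
      "\<forall>x\<in>?g J\<^sub>3. h x = h\<^sub>3 x"
      using free_product3_universal[OF V A P h1(1) h2(1) h3(1)] by blast
    then show ?thesis
      using h1(2) h2(2) h3(2) generated_subalgebra_incl[of J\<^sub>1 V F]
        generated_subalgebra_incl[of J\<^sub>2 V F] generated_subalgebra_incl[of J\<^sub>3 V F]
      by (intro bexI[of _ h]) auto
  qed
  obtain a b where ab: "a \<in> carrier F" "b \<in> carrier F" "a \<noteq> b"
  proof -
    obtain x where x: "x \<in> X\<^sub>1" using JX(1) ne(1) by blast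
    have "infinite (X\<^sub>1 - {x})" using J(1) by (simp add: moiety_def)
    then obtain y where "y \<in> X\<^sub>1 - {x}" using infinite_imp_nonempty by blast
    then show thesis using that[of x y] x F(3) by auto
  qed
  have const: "(\<lambda>_. a) \<in> J \<rightarrow> carrier F" "(\<lambda>_. b) \<in> J \<rightarrow> carrier F" for J :: "'b set"
    using ab by auto
  \<comment> \<open>A common element of two pieces would have to be sent both to \<open>a\<close>
    and to \<open>b\<close>; the patterns a, b, b and a, a, b separate all three pairs.\<close>
  show disj: "J\<^sub>1 \<inter> J\<^sub>2 = {}" "J\<^sub>1 \<inter> J\<^sub>3 = {}" "J\<^sub>2 \<inter> J\<^sub>3 = {}"
    using joint[OF F(1) const(1) const(2) const(2)] joint[OF F(1) const(1) const(1) const(2)] ab(3)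
    by (metis disjoint_iff)+
  have "J\<^sub>1 \<union> J\<^sub>2 \<union> J\<^sub>3 \<subseteq> carrier F" using JF by blast
  moreover have "?g (J\<^sub>1 \<union> J\<^sub>2 \<union> J\<^sub>3) = carrier F"
  proof -
    have "?g J\<^sub>1 \<union> ?g J\<^sub>2 \<union> ?g J\<^sub>3 \<subseteq> ?g (J\<^sub>1 \<union> J\<^sub>2 \<union> J\<^sub>3)"
      by (intro Un_least generated_subalgebra_mono) auto
    moreover have sub: "is_subalgebra V F (?g (J\<^sub>1 \<union> J\<^sub>2 \<union> J\<^sub>3))"
      using is_subalgebra_generated[OF F(2)] JF by simp
    moreover have "carrier F = ?g (?g J\<^sub>1 \<union> ?g J\<^sub>2 \<union> ?g J\<^sub>3)"
      using P by (simp add: free_product3_def)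
    ultimately have "carrier F \<subseteq> ?g (J\<^sub>1 \<union> J\<^sub>2 \<union> J\<^sub>3)"
      by (simp only: generated_subalgebra_minimal)
    then show ?thesis using sub by (auto simp: is_subalgebra_def)
  qed
  moreover have "\<exists>h \<in> alg_hom V F A. \<forall>x\<in>J\<^sub>1 \<union> J\<^sub>2 \<union> J\<^sub>3. h x = g x"
    if "in_variety V A" "g \<in> J\<^sub>1 \<union> J\<^sub>2 \<union> J\<^sub>3 \<rightarrow> carrier A" for A :: "('a, ('a, 'b) trm) alg" and g
  proof -
    have "g \<in> J\<^sub>1 \<rightarrow> carrier A" "g \<in> J\<^sub>2 \<rightarrow> carrier A" "g \<in> J\<^sub>3 \<rightarrow> carrier A" using that(2) by auto
    from joint[OF that(1) this] show ?thesis by (meson UnE)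
  qed
  ultimately show "free_basis V F (J\<^sub>1 \<union> J\<^sub>2 \<union> J\<^sub>3)"
    unfolding free_basis_def by (intro conjI allI impI ballI F(1))
qed

section \<open>Automorphisms of free algebras\<close>

lemma carrier_Aut: "carrier (Aut V F) = alg_hom V F F \<inter> Bij (carrier F)"
  by (simp add: Aut_def)

lemma mult_Aut_apply:
  assumes "g \<in> carrier (Aut V F)" "h \<in> carrier (Aut V F)" "x \<in> carrier F"
  shows "(g \<otimes>\<^bsub>Aut V F\<^esub> h) x = g (h x)"
  using assms by (simp add: Aut_def BijGroup_def compose_def)

lemma one_Aut_apply: "x \<in> carrier F \<Longrightarrow> \<one>\<^bsub>Aut V F\<^esub> x = x"
  by (simp add: Aut_def BijGroup_def)

lemma Aut_eqI:
  assumes "g \<in> carrier (Aut V F)" "h \<in> carrier (Aut V F)" "\<And>x. x \<in> carrier F \<Longrightarrow> g x = h x"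
  shows "g = h"
  using assms by (auto simp: carrier_Aut Bij_def intro: extensionalityI)

lemma inv_Aut_apply:
  assumes "is_algebra (sig V) F" "g \<in> carrier (Aut V F)" "x \<in> carrier F"
  shows "(inv\<^bsub>Aut V F\<^esub> g) (g x) = x" "g ((inv\<^bsub>Aut V F\<^esub> g) x) = x"
proof -
  interpret group "Aut V F" by (rule group_Aut[OF assms(1)])
  have i: "inv\<^bsub>Aut V F\<^esub> g \<in> carrier (Aut V F)" using assms(2) by (rule inv_closed)
  show "(inv\<^bsub>Aut V F\<^esub> g) (g x) = x"
    using mult_Aut_apply[OF i assms(2,3)] assms by (simp add: one_Aut_apply)
  show "g ((inv\<^bsub>Aut V F\<^esub> g) x) = x"
    using mult_Aut_apply[OF assms(2) i assms(3)] assms by (simp add: one_Aut_apply)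
qed

lemma subgroup_stab:
  assumes F: "is_algebra (sig V) F" and AB: "A \<subseteq> carrier F" "B \<subseteq> carrier F"
  shows "subgroup (stab V F A B) (Aut V F)"
proof -
  interpret group "Aut V F" by (rule group_Aut[OF F])
  show ?thesis
  proof (rule subgroupI)
    show "stab V F A B \<subseteq> carrier (Aut V F)" by (auto simp: stab_def)
    have "\<one>\<^bsub>Aut V F\<^esub> ` B = id ` B" 
      by (rule image_cong) (use AB in \<open>auto simp: one_Aut_apply subset_iff\<close>)
    then have "\<one>\<^bsub>Aut V F\<^esub> \<in> stab V F A B"
      using AB by (simp add: stab_def one_Aut_apply subset_iff)
    then show "stab V F A B \<noteq> {}" by blast
  next
    fix g assume g: "g \<in> stab V F A B"
    then have gG: "g \<in> carrier (Aut V F)" by (simp add: stab_def)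
    note i = inv_Aut_apply(1)[OF F gG]
    have "(inv\<^bsub>Aut V F\<^esub> g) a = a" if "a \<in> A" for a
      using i[of a] g that AB by (auto simp: stab_def)
    moreover have "(inv\<^bsub>Aut V F\<^esub> g) ` g ` B = id ` B"
      unfolding image_image by (rule image_cong) (use i AB in auto)
    ultimately show "inv\<^bsub>Aut V F\<^esub> g \<in> stab V F A B"
      using g gG by (simp add: stab_def)
  next
    fix g h assume g: "g \<in> stab V F A B" and h: "h \<in> stab V F A B"
    then have G: "g \<in> carrier (Aut V F)" "h \<in> carrier (Aut V F)" by (simp_all add: stab_def)
    have "(g \<otimes>\<^bsub>Aut V F\<^esub> h) ` B = g ` h ` B"
      unfolding image_image by (rule image_cong) (use mult_Aut_apply[OF G] AB in auto)
    moreover have "(g \<otimes>\<^bsub>Aut V F\<^esub> h) a = a" if "a \<in> A" for a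
      using mult_Aut_apply[OF G, of a] that AB g h by (auto simp: stab_def)
    ultimately show "g \<otimes>\<^bsub>Aut V F\<^esub> h \<in> stab V F A B"
      using g h G by (simp add: stab_def)
  qed
qed

text \<open>Restriction to the carrier is imposed because elements of \<open>Aut V F\<close> are
  extensional. For a free basis \<open>Y\<close> the result does not depend on the choice, as
  \<open>Y\<close> generates.\<close>

definition basis_extension ::
    "'f variety \<Rightarrow> ('f, 'a) alg \<Rightarrow> 'a set \<Rightarrow> ('a \<Rightarrow> 'a) \<Rightarrow> 'a \<Rightarrow> 'a" where
  "basis_extension V F Y f =
     restrict (SOME h. h \<in> alg_hom V F F \<and> (\<forall>y\<in>Y. h y = f y)) (carrier F)"

lemma basis_extension:
  assumes V: "is_variety V" and Y: "free_basis V F Y" and f: "f \<in> Y \<rightarrow> carrier F"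
  shows "basis_extension V F Y f \<in> alg_hom V F F"
    and "basis_extension V F Y f \<in> extensional (carrier F)"
    and "y \<in> Y \<Longrightarrow> basis_extension V F Y f y = f y"
proof -
  note F = free_basisD[OF Y]
  define h where "h = (SOME h. h \<in> alg_hom V F F \<and> (\<forall>y\<in>Y. h y = f y))"
  have eq: "basis_extension V F Y f = restrict h (carrier F)"
    by (simp add: basis_extension_def h_def)
  from free_basis_universal[OF V F(1) Y f]
  have "\<exists>h. h \<in> alg_hom V F F \<and> (\<forall>y\<in>Y. h y = f y)" by blast
  then have h: "h \<in> alg_hom V F F \<and> (\<forall>y\<in>Y. h y = f y)" unfolding h_def by (rule someI_ex)
  show "basis_extension V F Y f \<in> alg_hom V F F"
    unfolding eq by (rule alg_hom_cong[OF F(2) conjunct1[OF h]]) simp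
  show "basis_extension V F Y f \<in> extensional (carrier F)" by (simp add: eq)
  show "basis_extension V F Y f y = f y" if "y \<in> Y" using that F(3) h by (auto simp: eq)
qed

text \<open>Both composites are homomorphisms agreeing with the identity on generators, so
  bijectivity need only be tested on a basis.\<close>

lemma Aut_memI:
  assumes "is_algebra (sig V) F" "X \<subseteq> carrier F" "generated_subalgebra V F X = carrier F"
    and h: "h \<in> alg_hom V F F" "h \<in> extensional (carrier F)" and k: "k \<in> alg_hom V F F"
    and inverse: "\<And>x. x \<in> X \<Longrightarrow> k (h x) = x" "\<And>x. x \<in> X \<Longrightarrow> h (k x) = x"
  shows "h \<in> carrier (Aut V F)"
proof -
  have id: "id \<in> alg_hom V F F" by (simp add: alg_hom_def)
  have x: "x \<in> generated_subalgebra V F X" if "x \<in> carrier F" for x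
    using that assms(3) by simp
  have "(k \<circ> h) x = id x" if "x \<in> carrier F" for x
    by (rule alg_hom_eqI[OF assms(1,2) alg_hom_comp[OF h(1) k] id _ x[OF that]])
      (simp add: inverse)
  moreover have "(h \<circ> k) x = id x" if "x \<in> carrier F" for x
    by (rule alg_hom_eqI[OF assms(1,2) alg_hom_comp[OF k h(1)] id _ x[OF that]])
      (simp add: inverse)
  ultimately have "bij_betw h (carrier F) (carrier F)"
    using h(1) k by (intro bij_betwI[of _ _ _ k]) (auto simp: alg_hom_def)
  then show ?thesis using h by (simp add: carrier_Aut Bij_def)
qed

text \<open>
  The basis \<open>Y\<close> is laid out as a grid of copies \<open>b ` (J \<times> {t})\<close> of \<open>J\<close>, with \<open>J\<close> itself at the
  origin.
\<close>

locale free_grid =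
  fixes V :: "'f variety" and F :: "('f, 'a) alg" and Y J :: "'a set"
    and b :: "'a \<times> (int \<times> int) \<Rightarrow> 'a"
  assumes V: "is_variety V" and Y: "free_basis V F Y"
    and b: "bij_betw b (J \<times> UNIV) Y"
    and b_origin: "j \<in> J \<Longrightarrow> b (j, (0, 0)) = j"
begin

text \<open>This moves the subalgebra generated by \<open>J\<close> to its copy at \<open>t\<close>.
  It is merely an endomorphism: basis elements outside \<open>J\<close> stay in place, so it is in
  general not injective.\<close>

definition place :: "int \<times> int \<Rightarrow> 'a \<Rightarrow> 'a" where
  "place t = basis_extension V F Y (\<lambda>y. if y \<in> J then b (y, t) else y)"

text \<open>\<open>inv_into\<close> reads off the grid coordinates of a basis element. On the copy
  at \<open>t\<close> the map acts as \<open>k t\<close> does on the original, transported by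
  \<open>place t\<close>.\<close>

definition diagonal :: "(int \<times> int \<Rightarrow> 'a \<Rightarrow> 'a) \<Rightarrow> 'a \<Rightarrow> 'a" where
  "diagonal k = basis_extension V F Y
     (\<lambda>y. let (j, t) = inv_into (J \<times> UNIV) b y in place t (k t j))"

definition permute :: "(int \<times> int \<Rightarrow> int \<times> int) \<Rightarrow> 'a \<Rightarrow> 'a" where
  "permute \<sigma> = basis_extension V F Y
     (\<lambda>y. let (j, t) = inv_into (J \<times> UNIV) b y in b (j, \<sigma> t))"

abbreviation "H \<equiv> stab V F (generated_subalgebra V F (Y - J)) (generated_subalgebra V F J)"

lemmas F = free_basisD[OF Y]

lemma b_in: "j \<in> J \<Longrightarrow> b (j, t) \<in> Y"
  using b by (auto simp: bij_betw_def)

lemma b_carrier: "j \<in> J \<Longrightarrow> b (j, t) \<in> carrier F"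
  using b_in F(3) by blast

lemma b_inv: "j \<in> J \<Longrightarrow> inv_into (J \<times> UNIV) b (b (j, t)) = (j, t)"
  using b by (simp add: bij_betw_def)

lemma grid_cases:
  assumes "y \<in> Y"
  obtains j t where "j \<in> J" "y = b (j, t)"
  using assms b by (auto simp: bij_betw_def)

lemma J_sub: "J \<subseteq> Y" "J \<subseteq> carrier F"
  using b_in[of _ "(0, 0)"] b_origin F(3) by auto

lemma grid_hom_eqI:
  assumes "h \<in> alg_hom V F F" "k \<in> alg_hom V F F"
    and "\<And>j t. j \<in> J \<Longrightarrow> h (b (j, t)) = k (b (j, t))" "x \<in> carrier F"
  shows "h x = k x"
proof (rule alg_hom_eqI[OF F(2,3) assms(1,2)])
  show "h y = k y" if "y \<in> Y" for y using that assms(3) by (auto elim: grid_cases)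
qed (use assms(4) F(4) in simp)

lemma subgroup_H: "subgroup H (Aut V F)"
proof -
  have "is_subalgebra V F (generated_subalgebra V F X)" if "X \<subseteq> Y" for X
    using is_subalgebra_generated[OF F(2)] that F(3) by simp
  then show ?thesis
    using J_sub by (intro subgroup_stab F(2)) (simp_all add: is_subalgebra_def)
qed

lemma H_D:
  assumes "h \<in> H"
  shows "h \<in> carrier (Aut V F)" "h \<in> alg_hom V F F"
    "x \<in> generated_subalgebra V F J \<Longrightarrow> h x \<in> generated_subalgebra V F J"
    "y \<in> Y - J \<Longrightarrow> h y = y"
  using assms generated_subalgebra_incl[of "Y - J" V F] by (auto simp: stab_def carrier_Aut)

lemma J_generated: "j \<in> J \<Longrightarrow> j \<in> generated_subalgebra V F J"
  using generated_subalgebra_incl by (rule subsetD)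

lemma generated_carrier: "x \<in> generated_subalgebra V F J \<Longrightarrow> x \<in> carrier F"
  using is_subalgebra_generated[OF F(2) J_sub(2)] by (auto simp: is_subalgebra_def)

section \<open>Copies of \<open>J\<close>, diagonal maps and permutations of the grid\<close>

lemma place:
  shows place_hom: "place t \<in> alg_hom V F F"
    and place_basis: "j \<in> J \<Longrightarrow> place t j = b (j, t)"
proof -
  have f: "(\<lambda>y. if y \<in> J then b (y, t) else y) \<in> Y \<rightarrow> carrier F"
    using b_carrier[of _ t] F(3) by auto
  show "place t \<in> alg_hom V F F"
    unfolding place_def by (rule basis_extension(1)[OF V Y f])
  show "place t j = b (j, t)" if "j \<in> J"
    unfolding place_def using basis_extension(3)[OF V Y f, of j] that J_sub(1) by auto
qed

lemma place_origin: "x \<in> generated_subalgebra V F J \<Longrightarrow> place (0, 0) x = x"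
  using alg_hom_eqI[OF F(2) J_sub(2) place_hom, where k = id]
  by (simp add: place_basis b_origin alg_hom_def)

lemma place_carrier: "x \<in> carrier F \<Longrightarrow> place t x \<in> carrier F"
  using place_hom[of t] by (auto simp: alg_hom_def)

lemma diagonal:
  assumes k: "range k \<subseteq> H"
  shows diagonal_hom: "diagonal k \<in> alg_hom V F F"
    and diagonal_ext: "diagonal k \<in> extensional (carrier F)"
    and diagonal_basis: "j \<in> J \<Longrightarrow> diagonal k (b (j, t)) = place t (k t j)"
proof -
  let ?f = "\<lambda>y. let (j, t) = inv_into (J \<times> UNIV) b y in place t (k t j)"
  have kH: "k t \<in> H" for t using k by blast
  have kj: "place t (k t j) \<in> carrier F" if "j \<in> J" for j t
    by (intro place_carrier generated_carrier H_D(3)[OF kH] J_generated that)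
  have f: "?f \<in> Y \<rightarrow> carrier F" by (auto elim!: grid_cases simp: b_inv kj)
  show "diagonal k \<in> alg_hom V F F" "diagonal k \<in> extensional (carrier F)"
    unfolding diagonal_def using basis_extension(1,2)[OF V Y f] by blast+
  show "diagonal k (b (j, t)) = place t (k t j)" if "j \<in> J"
    unfolding diagonal_def using basis_extension(3)[OF V Y f b_in[OF that]]
    by (simp add: b_inv that)
qed

text \<open>Two homomorphisms in \<open>x\<close> agree on \<open>J\<close>. The passage from
  \<open>J\<close> to the generated subalgebra is essential for composing diagonal maps, since
  \<open>k t\<close> may send an element of \<open>J\<close> to any element of that
  subalgebra.\<close>

lemma diagonal_place:
  assumes k: "range k \<subseteq> H" and x: "x \<in> generated_subalgebra V F J"
  shows "diagonal k (place t x) = place t (k t x)"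
proof -
  have "k t \<in> H" using k by blast
  note comp = alg_hom_comp[OF place_hom diagonal_hom[OF k]]
    alg_hom_comp[OF H_D(2)[OF \<open>k t \<in> H\<close>] place_hom]
  have "(diagonal k \<circ> place t) x = (place t \<circ> k t) x"
    by (rule alg_hom_eqI[OF F(2) J_sub(2) comp _ x]) (simp add: place_basis diagonal_basis[OF k])
  then show ?thesis by simp
qed

lemma permute:
  shows permute_hom: "permute \<sigma> \<in> alg_hom V F F"
    and permute_ext: "permute \<sigma> \<in> extensional (carrier F)"
    and permute_basis: "j \<in> J \<Longrightarrow> permute \<sigma> (b (j, t)) = b (j, \<sigma> t)"
proof -
  let ?f = "\<lambda>y. let (j, t) = inv_into (J \<times> UNIV) b y in b (j, \<sigma> t)"
  have f: "?f \<in> Y \<rightarrow> carrier F" by (auto elim!: grid_cases simp: b_inv b_carrier)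
  show "permute \<sigma> \<in> alg_hom V F F" "permute \<sigma> \<in> extensional (carrier F)"
    unfolding permute_def using basis_extension(1,2)[OF V Y f] by blast+
  show "permute \<sigma> (b (j, t)) = b (j, \<sigma> t)" if "j \<in> J"
    unfolding permute_def using basis_extension(3)[OF V Y f b_in[OF that]]
    by (simp add: b_inv that)
qed

lemma permute_place:
  assumes x: "x \<in> generated_subalgebra V F J"
  shows "permute \<sigma> (place t x) = place (\<sigma> t) x"
proof -
  have "(permute \<sigma> \<circ> place t) x = place (\<sigma> t) x"
    by (rule alg_hom_eqI[OF F(2) J_sub(2) alg_hom_comp[OF place_hom permute_hom] place_hom _ x])
      (simp add: place_basis permute_basis)
  then show ?thesis by simp
qed

text \<open>The family of inverses stays in the group \<open>H\<close>, and its diagonal map is the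
  inverse.\<close>

lemma diagonal_Aut:
  assumes k: "range k \<subseteq> H"
  shows "diagonal k \<in> carrier (Aut V F)"
proof -
  let ?l = "\<lambda>t. inv\<^bsub>Aut V F\<^esub> (k t)"
  have kH: "k t \<in> H" for t using k by blast
  then have lH: "?l t \<in> H" for t by (rule subgroup.m_inv_closed[OF subgroup_H])
  then have l: "range ?l \<subseteq> H" by blast
  note i = inv_Aut_apply[OF F(2) H_D(1)[OF kH]]
  show ?thesis
  proof (rule Aut_memI[OF F(2,3,4) diagonal_hom[OF k] diagonal_ext[OF k] diagonal_hom[OF l]])
    fix y assume "y \<in> Y"
    then obtain j t where y: "j \<in> J" "y = b (j, t)" by (rule grid_cases)
    have "j \<in> carrier F" using y(1) J_sub by blast
    then show "diagonal ?l (diagonal k y) = y" "diagonal k (diagonal ?l y) = y"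
      using y by (simp_all add: diagonal_basis[OF k] diagonal_basis[OF l] diagonal_place[OF k]
          diagonal_place[OF l] H_D(3)[OF kH] H_D(3)[OF lH] J_generated i place_basis)
  qed
qed

lemma permute_Aut:
  assumes "bij \<sigma>"
  shows "permute \<sigma> \<in> carrier (Aut V F)"
proof (rule Aut_memI[OF F(2,3,4) permute_hom permute_ext permute_hom[of "inv_into UNIV \<sigma>"]])
  fix y assume "y \<in> Y"
  then obtain j t where y: "j \<in> J" "y = b (j, t)" by (rule grid_cases)
  then show "permute (inv_into UNIV \<sigma>) (permute \<sigma> y) = y" "permute \<sigma> (permute (inv_into UNIV \<sigma>) y) = y"
    using assms by (simp_all add: permute_basis bij_is_inj bij_is_surj surj_f_inv_f)
qed

lemma grid_mult_eqI:
  assumes "p \<in> carrier (Aut V F)" "q \<in> carrier (Aut V F)" "r \<in> carrier (Aut V F)"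
    and "\<And>j t. j \<in> J \<Longrightarrow> p (q (b (j, t))) = r (b (j, t))"
  shows "p \<otimes>\<^bsub>Aut V F\<^esub> q = r"
proof -
  interpret group "Aut V F" by (rule group_Aut[OF F(2)])
  have pq: "p \<otimes>\<^bsub>Aut V F\<^esub> q \<in> carrier (Aut V F)" using assms(1,2) by (rule m_closed)
  then have hom: "p \<otimes>\<^bsub>Aut V F\<^esub> q \<in> alg_hom V F F" "r \<in> alg_hom V F F"
    using assms(3) by (simp_all add: carrier_Aut)
  show ?thesis
    by (rule Aut_eqI[OF pq assms(3)], rule grid_hom_eqI[OF hom])
      (simp_all add: mult_Aut_apply[OF assms(1,2)] b_carrier assms(4))
qed

lemma H_length_bounded:
  assumes S: "S \<subseteq> carrier (Aut V F)" "generate (Aut V F) S = carrier (Aut V F)"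
  obtains n where "\<And>x. x \<in> H \<Longrightarrow> group_length (Aut V F) S x \<le> enat n"
proof -
  interpret group "Aut V F" by (rule group_Aut[OF F(2)])
  \<comment> \<open>At the origin the copy is \<open>J\<close> itself; everywhere else both maps fix
    the basis, because \<open>x\<close> fixes \<open>Y - J\<close> pointwise.\<close>
  have single: "diagonal (\<lambda>t. if t = (0, 0) then x else \<one>\<^bsub>Aut V F\<^esub>) = x" if x: "x \<in> H" for x
  proof -
    let ?k = "\<lambda>t. if t = (0, 0) then x else \<one>\<^bsub>Aut V F\<^esub>"
    have k: "range ?k \<subseteq> H" using x subgroup.one_closed[OF subgroup_H] by auto
    show ?thesis
    proof (rule Aut_eqI[OF diagonal_Aut[OF k] H_D(1)[OF x]])
      show "diagonal ?k z = x z" if "z \<in> carrier F" for z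
      proof (rule grid_hom_eqI[OF diagonal_hom[OF k] H_D(2)[OF x] _ that])
        fix j t assume j: "j \<in> J"
        show "diagonal ?k (b (j, t)) = x (b (j, t))"
        proof (cases "t = (0, 0)")
          case True
          show ?thesis
            unfolding True diagonal_basis[OF k j]
            using j by (simp add: place_origin H_D(3)[OF x] J_generated b_origin)
        next
          case False
          \<comment> \<open>An element of \<open>J\<close> has itself and the origin as its
            coordinates.\<close>
          have "b (j, t) \<notin> J"
          proof
            assume bJ: "b (j, t) \<in> J"
            have "(b (j, t), (0, 0)) = (j, t)"
              using b_inv[OF bJ, of "(0, 0)"] b_inv[OF j, of t] b_origin[OF bJ] by (simp only:)
            then show False using False by simp
          qed
          then have "x (b (j, t)) = b (j, t)" using H_D(4)[OF x] b_in[OF j] by blast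
          then show ?thesis
            using False j J_sub(2)
            by (simp add: diagonal_basis[OF k] one_Aut_apply subsetD place_basis)
        qed
      qed
    qed
  qed
  have words: "\<exists>g \<in> carrier (Aut V F). \<exists>u \<in> carrier (Aut V F). \<exists>v \<in> carrier (Aut V F). \<forall>n.
      h n = (inv\<^bsub>Aut V F\<^esub> (u [^]\<^bsub>Aut V F\<^esub> n) \<otimes>\<^bsub>Aut V F\<^esub> g \<otimes>\<^bsub>Aut V F\<^esub> u [^]\<^bsub>Aut V F\<^esub> n) \<otimes>\<^bsub>Aut V F\<^esub>
        (v \<otimes>\<^bsub>Aut V F\<^esub> inv\<^bsub>Aut V F\<^esub> (inv\<^bsub>Aut V F\<^esub> (u [^]\<^bsub>Aut V F\<^esub> n) \<otimes>\<^bsub>Aut V F\<^esub> g \<otimes>\<^bsub>Aut V F\<^esub> u [^]\<^bsub>Aut V F\<^esub> n)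
          \<otimes>\<^bsub>Aut V F\<^esub> inv\<^bsub>Aut V F\<^esub> v)"
    if h: "range h \<subseteq> H" for h :: "nat \<Rightarrow> 'a \<Rightarrow> 'a"
  proof (rule commutator_isolates[where D = diagonal and P = permute and h = h, OF _ _ _ _ _ _ _ h])
    show "subgroup H (Aut V F)" by (rule subgroup_H)
    show "diagonal k \<in> carrier (Aut V F)" if "range k \<subseteq> H" for k
      using that by (rule diagonal_Aut)
    show "diagonal (\<lambda>t. if t = (0, 0) then x else \<one>\<^bsub>Aut V F\<^esub>) = x" if "x \<in> H" for x
      using that by (rule single)
    show "permute \<sigma> \<in> carrier (Aut V F)" if "bij \<sigma>" for \<sigma>
      using that by (rule permute_Aut)
    show "permute \<sigma> \<otimes>\<^bsub>Aut V F\<^esub> permute \<tau> = permute (\<sigma> \<circ> \<tau>)" if "bij \<sigma>" "bij \<tau>" for \<sigma> \<tau>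
      by (intro grid_mult_eqI permute_Aut that bij_comp) (simp_all add: permute_basis)
    \<comment> \<open>\<open>l t\<close> keeps \<open>j\<close> in the subalgebra generated by
      \<open>J\<close>, so \<open>diagonal_place\<close> applies to the second factor
      applied.\<close>
    show "diagonal k \<otimes>\<^bsub>Aut V F\<^esub> diagonal l = diagonal (\<lambda>t. k t \<otimes>\<^bsub>Aut V F\<^esub> l t)"
      if k: "range k \<subseteq> H" and l: "range l \<subseteq> H" for k l
    proof -
      have kH: "k t \<in> H" and lH: "l t \<in> H" for t using k l by blast+
      then have "k t \<otimes>\<^bsub>Aut V F\<^esub> l t \<in> H" for t by (rule subgroup.m_closed[OF subgroup_H])
      then have m: "range (\<lambda>t. k t \<otimes>\<^bsub>Aut V F\<^esub> l t) \<subseteq> H" by blast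
      show ?thesis
      proof (rule grid_mult_eqI[OF diagonal_Aut[OF k] diagonal_Aut[OF l] diagonal_Aut[OF m]])
        fix j t assume j: "j \<in> J"
        then have "j \<in> carrier F" using J_sub(2) by blast
        then show "diagonal k (diagonal l (b (j, t))) = diagonal (\<lambda>t. k t \<otimes>\<^bsub>Aut V F\<^esub> l t) (b (j, t))"
          using j by (simp add: diagonal_basis[OF l] diagonal_basis[OF m] diagonal_place[OF k]
              H_D(3)[OF lH] J_generated mult_Aut_apply[OF H_D(1)[OF kH] H_D(1)[OF lH]])
      qed
    qed
    \<comment> \<open>Both sides send \<open>b (j, t)\<close> to
      \<open>place (\<sigma> t) (k (\<sigma> t) j)\<close>.\<close>
    show "diagonal k \<otimes>\<^bsub>Aut V F\<^esub> permute \<sigma> = permute \<sigma> \<otimes>\<^bsub>Aut V F\<^esub> diagonal (k \<circ> \<sigma>)"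
      if k: "range k \<subseteq> H" and \<sigma>: "bij \<sigma>" for k \<sigma>
    proof -
      have k\<sigma>: "range (k \<circ> \<sigma>) \<subseteq> H" using k by auto
      have kH: "k t \<in> H" for t using k by blast
      note A = diagonal_Aut[OF k] permute_Aut[OF \<sigma>] diagonal_Aut[OF k\<sigma>]
      show ?thesis
        by (rule grid_mult_eqI[OF A(1,2) m_closed[OF A(2,3)]])
          (simp add: mult_Aut_apply[OF A(2,3)] b_carrier permute_basis diagonal_basis[OF k]
            diagonal_basis[OF k\<sigma>] permute_place H_D(3)[OF kH] J_generated)
    qed
  qed
  show thesis by (rule group_length_bounded[OF S words that])
qed

end

text \<open>The positions other than the origin form a nonempty countable set, so the copies of the
  infinite set \<open>J\<close> there have together the size of \<open>J\<close>, hence of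
  \<open>Y - J\<close>. The copy at the origin is glued in by the identity.\<close>

lemma grid_exists:
  assumes J: "J \<subseteq> Y" "infinite J" "Y - J \<approx> J"
  obtains b :: "'a \<times> (int \<times> int) \<Rightarrow> 'a"
  where "bij_betw b (J \<times> UNIV) Y" "\<And>j. j \<in> J \<Longrightarrow> b (j, (0, 0)) = j"
proof -
  let ?T = "UNIV - {(0, 0)} :: (int \<times> int) set"
  have "?T \<lesssim> (UNIV :: nat set)"
    unfolding lepoll_def by (intro exI[of _ to_nat] conjI subset_UNIV inj_on_subset[OF inj_to_nat])
  also have "(UNIV :: nat set) \<lesssim> J" using J(2) by (simp only: infinite_le_lepoll)
  finally have "ordLeq3 (card_of ?T) (card_of J)" by (simp add: lepoll_iff_ordLeq)
  moreover have "(0, 1) \<in> ?T" by simp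
  then have "?T \<noteq> {}" by (metis empty_iff)
  ultimately have "J \<times> ?T \<approx> J"
    unfolding eqpoll_iff_card_of_ordIso by (intro card_of_Times_infinite_simps(1) J(2))
  then have "J \<times> ?T \<approx> Y - J" using J(3) by (meson eqpoll_sym eqpoll_trans)
  then obtain c where c: "bij_betw c (J \<times> ?T) (Y - J)" unfolding eqpoll_def by (rule exE)
  define b where "b = (\<lambda>(j, t). if t = (0, 0) then j else c (j, t))"
  have "bij_betw b (J \<times> {(0, 0)}) J" 
    by (rule bij_betwI[of _ _ _ "\<lambda>j. (j, (0, 0))"]) (auto simp: b_def)
  moreover have "bij_betw b (J \<times> ?T) (Y - J)"
    by (rule bij_betw_cong[THEN iffD1, OF _ c]) (auto simp: b_def split: if_split_asm)
  ultimately have "bij_betw b (J \<times> {(0, 0)} \<union> J \<times> ?T) (J \<union> (Y - J))"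
    by (rule bij_betw_combine) blast
  moreover have "J \<times> {(0, 0)} \<union> J \<times> ?T = J \<times> UNIV" by auto
  moreover have "J \<union> (Y - J) = Y" using J(1) by blast
  ultimately have "bij_betw b (J \<times> UNIV) Y" by (simp only:)
  then show thesis by (rule that) (simp add: b_def)
qed

lemma stab_length_bounded:
  fixes F :: "('f, 'a) alg"
  assumes V: "is_variety V" and Y: "free_basis V F Y" "J \<subseteq> Y" "infinite J" "Y - J \<approx> J"
    and S: "S \<subseteq> carrier (Aut V F)" "generate (Aut V F) S = carrier (Aut V F)"
  obtains n where "\<And>x. x \<in> stab V F (generated_subalgebra V F (Y - J)) (generated_subalgebra V F J)
    \<Longrightarrow> group_length (Aut V F) S x \<le> enat n"
proof -
  obtain b :: "'a \<times> (int \<times> int) \<Rightarrow> 'a"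
    where b: "bij_betw b (J \<times> UNIV) Y" "\<And>j. j \<in> J \<Longrightarrow> b (j, (0, 0)) = j"
    using grid_exists[OF Y(2,3,4)] by blast
  interpret free_grid V F Y J b by (rule free_grid.intro[OF V Y(1) b])
  show thesis by (rule H_length_bounded[OF S that])
qed

section \<open>Universally finite width\<close>

theorem theorem2p4:
  fixes V :: "'f variety" and F :: "('f, 'a) alg"
  assumes "BMN_variety TYPE('a) V"
    and "free_of_infinite_rank V F"
  shows "universally_finite_width (Aut V F) \<longleftrightarrow>
    (\<exists>U\<^sub>1 U\<^sub>2 W.
       moietous V F U\<^sub>1 \<and> moietous V F U\<^sub>2 \<and> moietous V F W \<and> free_product3 V F U\<^sub>1 U\<^sub>2 W \<and>
       group_width (Aut V F)
         (stab V F U\<^sub>2 (generated_subalgebra V F (U\<^sub>1 \<union> W)) \<union>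
          stab V F U\<^sub>1 (generated_subalgebra V F (U\<^sub>2 \<union> W))) < \<infinity>)"
    (is "_ \<longleftrightarrow> ?R")
proof -
  have V: "is_variety V" using assms(1) by (simp add: BMN_variety_def)
  show ?thesis
  proof
    assume ufw: "universally_finite_width (Aut V F)"
    obtain X where X: "free_basis V F X" "infinite X"
      using assms(2) by (auto simp: free_of_infinite_rank_def)
    obtain J\<^sub>1 J\<^sub>2 J\<^sub>3 where J: "X = J\<^sub>1 \<union> J\<^sub>2 \<union> J\<^sub>3" "J\<^sub>1 \<inter> J\<^sub>2 = {}" "J\<^sub>1 \<inter> J\<^sub>3 = {}"
      "J\<^sub>2 \<inter> J\<^sub>3 = {}" "moiety X J\<^sub>1" "moiety X J\<^sub>2" "moiety X J\<^sub>3"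
      using infinite_split3[OF X(2)] by metis
    define U\<^sub>1 U\<^sub>2 W where U: "U\<^sub>1 = generated_subalgebra V F J\<^sub>1"
      "U\<^sub>2 = generated_subalgebra V F J\<^sub>2" "W = generated_subalgebra V F J\<^sub>3"
    let ?S = "stab V F U\<^sub>2 (generated_subalgebra V F (U\<^sub>1 \<union> W)) \<union>
      stab V F U\<^sub>1 (generated_subalgebra V F (U\<^sub>2 \<union> W))"
    have m: "moietous V F U\<^sub>1" "moietous V F U\<^sub>2" "moietous V F W"
      using X(1) J(5,6,7) unfolding U moietous_def by blast+
    have P: "free_product3 V F U\<^sub>1 U\<^sub>2 W"
      unfolding U by (rule free_product3_partition[OF V X(1) J(1-4)])
    \<comment> \<open>The BMN property makes the two stabilizers a generating set, to which
      universally finite width applies.\<close>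
    have "generate (Aut V F) ?S = carrier (Aut V F)"
      using assms m P unfolding BMN_variety_def by blast
    moreover have "?S \<subseteq> carrier (Aut V F)" by (auto simp: stab_def)
    ultimately have "group_width (Aut V F) ?S < \<infinity>"
      using ufw by (simp add: universally_finite_width_def)
    with m P show ?R by blast
  next
    assume ?R
    then obtain U\<^sub>1 U\<^sub>2 W where m: "moietous V F U\<^sub>1" "moietous V F U\<^sub>2" "moietous V F W"
      and P: "free_product3 V F U\<^sub>1 U\<^sub>2 W"
      and width: "group_width (Aut V F)
        (stab V F U\<^sub>2 (generated_subalgebra V F (U\<^sub>1 \<union> W)) \<union>
         stab V F U\<^sub>1 (generated_subalgebra V F (U\<^sub>2 \<union> W))) < \<infinity>" by blast
    obtain X\<^sub>1 J\<^sub>1 where J1: "free_basis V F X\<^sub>1" "moiety X\<^sub>1 J\<^sub>1" "U\<^sub>1 = generated_subalgebra V F J\<^sub>1"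
      using m(1) unfolding moietous_def by blast
    obtain X\<^sub>2 J\<^sub>2 where J2: "free_basis V F X\<^sub>2" "moiety X\<^sub>2 J\<^sub>2" "U\<^sub>2 = generated_subalgebra V F J\<^sub>2"
      using m(2) unfolding moietous_def by blast
    obtain X\<^sub>3 J\<^sub>3 where J3: "free_basis V F X\<^sub>3" "moiety X\<^sub>3 J\<^sub>3" "W = generated_subalgebra V F J\<^sub>3"
      using m(3) unfolding moietous_def by blast
    \<comment> \<open>The three moieties may come from different bases; the free product
      decomposition makes their union a single basis.\<close>
    define Y where "Y = J\<^sub>1 \<union> J\<^sub>2 \<union> J\<^sub>3"
    note product = free_basis_of_product[OF V J1(1) J2(1) J3(1) J1(2) J2(2) J3(2)
        P[unfolded J1(3) J2(3) J3(3)]]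
    have Y: "free_basis V F Y" unfolding Y_def by (rule product(1))
    note F = free_basisD[OF Y]
    interpret group "Aut V F" by (rule group_Aut[OF F(2)])
    have inf: "infinite X\<^sub>1" "infinite X\<^sub>2" "infinite X\<^sub>3"
      using J1(2) J2(2) J3(2) by (simp_all add: moiety_def)
    note e = moiety_eqpoll[OF J1(2)] moiety_eqpoll[OF J2(2)] moiety_eqpoll[OF J3(2)]
    have e12: "J\<^sub>1 \<approx> J\<^sub>2"
      using e(1,2) free_basis_eqpoll[OF V J1(1) inf(1) J2(1) inf(2)]
      by (meson eqpoll_sym eqpoll_trans)
    have e13: "J\<^sub>1 \<approx> J\<^sub>3"
      using e(1,3) free_basis_eqpoll[OF V J1(1) inf(1) J3(1) inf(3)]
      by (meson eqpoll_sym eqpoll_trans)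
    have J_inf: "infinite J\<^sub>1" "infinite J\<^sub>2" "infinite J\<^sub>3"
      using e inf eqpoll_finite_iff by metis+
    \<comment> \<open>The grid requires the pointwise fixed part \<open>A\<close> of the basis to be
      equipotent to the remaining part.\<close>
    have Un_eqpoll: "A \<approx> B \<union> J\<^sub>3" if "infinite A" "A \<approx> B" "A \<approx> J\<^sub>3" for A B :: "'a set"
    proof (rule lepoll_antisym)
      have "A \<lesssim> B" using that(2) by (rule eqpoll_imp_lepoll)
      also have "B \<lesssim> B \<union> J\<^sub>3" by (simp add: subset_imp_lepoll)
      finally show "A \<lesssim> B \<union> J\<^sub>3" .
      show "B \<union> J\<^sub>3 \<lesssim> A"
        using that by (intro Un_lepoll_infinite) (simp_all add: eqpoll_imp_lepoll eqpoll_sym)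
    qed
    \<comment> \<open>Here \<open>B \<union> J\<^sub>3\<close> is the moiety at the origin of the
      grid and \<open>A\<close> its complement. The two stabilizers arise by exchanging
      \<open>J\<^sub>1\<close> and \<open>J\<^sub>2\<close>.\<close>
    have bounded: "\<exists>n. \<forall>x \<in> stab V F (generated_subalgebra V F A) (generated_subalgebra V F
        (generated_subalgebra V F B \<union> W)). group_length (Aut V F) S x \<le> enat n"
      if S: "S \<subseteq> carrier (Aut V F)" "generate (Aut V F) S = carrier (Aut V F)"
        and AB: "Y = A \<union> B \<union> J\<^sub>3" "A \<inter> B = {}" "A \<inter> J\<^sub>3 = {}" "infinite B" "A \<approx> B \<union> J\<^sub>3"
      for S A B
    proof -
      have eq: "generated_subalgebra V F (generated_subalgebra V F B \<union> W) =
          generated_subalgebra V F (B \<union> J\<^sub>3)"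
        unfolding J3(3) using F(2,3) AB(1) by (intro generated_subalgebra_Un) auto
      have YA: "Y - (B \<union> J\<^sub>3) = A" "B \<union> J\<^sub>3 \<subseteq> Y" using AB(1-3) by blast+
      have "infinite (B \<union> J\<^sub>3)" using AB(4) by simp
      from stab_length_bounded[OF V Y YA(2) this _ S, unfolded YA(1), OF AB(5)]
      show ?thesis unfolding eq by metis
    qed
    show "universally_finite_width (Aut V F)"
      unfolding universally_finite_width_def
    proof (intro allI impI)
      fix S assume "S \<subseteq> carrier (Aut V F) \<and> generate (Aut V F) S = carrier (Aut V F)"
      then have S: "S \<subseteq> carrier (Aut V F)" "generate (Aut V F) S = carrier (Aut V F)" by simp_all
      have Y21: "Y = J\<^sub>2 \<union> J\<^sub>1 \<union> J\<^sub>3" "J\<^sub>2 \<inter> J\<^sub>1 = {}"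
        using product(2) unfolding Y_def by blast+
      have "J\<^sub>2 \<approx> J\<^sub>1 \<union> J\<^sub>3"
        by (rule Un_eqpoll[OF J_inf(2) eqpoll_sym[OF e12] eqpoll_trans[OF eqpoll_sym[OF e12] e13]])
      from bounded[OF S Y21 product(4) J_inf(1) this]
      obtain n\<^sub>2 where n2: "\<And>x. x \<in> stab V F U\<^sub>2 (generated_subalgebra V F (U\<^sub>1 \<union> W)) \<Longrightarrow>
          group_length (Aut V F) S x \<le> enat n\<^sub>2"
        unfolding J1(3) J2(3) by blast
      from bounded[OF S Y_def product(2,3) J_inf(2) Un_eqpoll[OF J_inf(1) e12 e13]]
      obtain n\<^sub>1 where n1: "\<And>x. x \<in> stab V F U\<^sub>1 (generated_subalgebra V F (U\<^sub>2 \<union> W)) \<Longrightarrow>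
          group_length (Aut V F) S x \<le> enat n\<^sub>1"
        unfolding J1(3) J2(3) by blast
      show "group_width (Aut V F) S < \<infinity>"
      \<comment> \<open>The stabilizers have uniformly bounded \<open>S\<close>-length, and every
        automorphism is a product of boundedly many of their elements.\<close>
      proof (rule group_width_finite_trans[OF S(1) width])
        fix x
        assume "x \<in> stab V F U\<^sub>2 (generated_subalgebra V F (U\<^sub>1 \<union> W)) \<union>
          stab V F U\<^sub>1 (generated_subalgebra V F (U\<^sub>2 \<union> W))"
        then have "group_length (Aut V F) S x \<le> enat n\<^sub>1 \<or> group_length (Aut V F) S x \<le> enat n\<^sub>2"
          using n1 n2 by blast
        moreover have "enat n\<^sub>1 \<le> enat (max n\<^sub>1 n\<^sub>2)" "enat n\<^sub>2 \<le> enat (max n\<^sub>1 n\<^sub>2)" by simp_all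
        ultimately show "group_length (Aut V F) S x \<le> enat (max n\<^sub>1 n\<^sub>2)"
          by (meson order_trans)
      qed
    qed
  qed
qed

end
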